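(* Let $\alpha,\beta\in\mathbb{R}^+$ satisfy $\alpha\beta=\pi^2$ and let $k,m\in\mathbb{N}$. Then $$ \begin{aligned} \beta^{km}\sum_{n=0}^{\infty}\frac{(-1)^nG_\alpha(n+b,a;k)}{(n+b)^{2km+1}} &=(-1)^{m+1}\alpha^{km}\sum_{n=0}^{\infty}\frac{(-1)^nG_\beta(n+a,b;k)}{(n+a)^{2km+1}}\\ &\quad+\frac1\pi\sum_{p=0}^{m}(-1)^p\zeta_E(2kp+1,a)\,\zeta_E(2k(m-p)+1,b)\,\alpha^{kp}\beta^{k(m-p)}. \end{aligned} $$ This identity can be rewritten as $$ \begin{aligned} &(-1)^{m}\alpha^{km}\sum_{n=0}^{\infty}\frac{(-1)^n\beta^k}{(n+a)^{2k(m-1)+1}}\sum_{i=0}^{\infty}\frac{(-1)^i}{(i+b)\left(\alpha^k(i+b)^{2k}+\beta^k(n+a)^{2k}\right)}\\ &=\beta^{km}\sum_{n=0}^{\infty}\frac{(-1)^n\alpha^k}{(n+b)^{2k(m-1)+1}}\sum_{i=0}^{\infty}\frac{(-1)^i}{(i+a)\left(\beta^k(i+a)^{2k}+\alpha^k(n+b)^{2k}\right)}\\ &\quad+\sum_{p=1}^{m-1}(-1)^p\zeta_E(2kp+1,a)\,\zeta_E(2k(m-p)+1,b)\,\alpha^{kp}\beta^{k(m-p)}. \end{aligned} $$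
   Context: $\mathbb{N}$ is the set of positive integers. The alternating Hurwitz zeta function is $\zeta_E(z,x)=\sum_{n=0}^{\infty}\frac{(-1)^n}{(n+x)^z}$ for $\operatorname{Re}(z)>0$, $x\ne0,-1,-2,\dots$, continued analytically in $z$ to all of $\mathbb{C}$; the alternating digamma function is $\widetilde{\psi}(x)=-\zeta_E(1,x)$. For $x\in\mathbb{R}^+$, $a\in\mathbb{C}$ and $k\in\mathbb{N}$, the odd-order alternating Hurwitz kernel is $$G(x,a;k)=\frac{1}{2\pi i}\int_{(c)}\frac{\zeta_E(1-s,a)}{2k\sin\left(\frac{\pi s}{2k}\right)}x^{-s}\,ds=-\frac{\widetilde{\psi}(a)}{\pi}-\frac{x^{2k}}{\pi}\sum_{n=0}^{\infty}\frac{(-1)^n}{(n+a)\left((n+a)^{2k}+x^{2k}\right)},$$ where $(c)$ is the vertical line $\operatorname{Re}(s)=c$ with $1<c<2$. Write $G_\alpha(x,a;k)=G\!\left(\frac{\alpha x}{\pi},a;k\right)$, and similarly $G_\beta$. The numbers $a,b$ are parameters for which these expressions are defined. An empty sum is $0$.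
   Formalization: In the second (rewritten) identity the sign (-1)^m on the left side is corrected to (-1)^{m+1}; as printed it fails for m=k=1, α=β=π, a=b=1, where it reads -S=S with S>0. *)

theory Defs
  imports "HOL-Complex_Analysis.Complex_Analysis"
begin

(* The alternating Hurwitz zeta function: the entire function of z that extends the series
   sum_n (-1)^n / (n + x)^z from the half plane Re z > 0.  Meaningful for x not in
   {0, -1, -2, ...}; the identity theorem makes the extension unique.  Powers are principal. *)
definition zeta_E :: "complex \<Rightarrow> complex \<Rightarrow> complex" where
  "zeta_E z x =
     (THE f. f holomorphic_on UNIV \<and>
        (\<forall>w. Re w > 0 \<longrightarrow> (\<lambda>n. (-1) ^ n / (of_nat n + x) powr w) sums f w)) z"

(* Upward integral along the line Re s = c, parametrised by s = c + i t.  It is a Lebesgue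
   integral, hence 0 by convention when the integrand is not absolutely integrable. *)
definition vertical_integral :: "real \<Rightarrow> (complex \<Rightarrow> complex) \<Rightarrow> complex" where
  "vertical_integral c F = \<i> * (\<integral>t. F (Complex c t) \<partial>lborel)"

(* The odd-order alternating Hurwitz kernel G(x,a;k); it does not depend on the abscissa
   c in (1,2).  The argument x may be complex (principal power); positive real x is the
   classical case. *)
definition kernel_G :: "real \<Rightarrow> complex \<Rightarrow> complex \<Rightarrow> nat \<Rightarrow> complex" where
  "kernel_G c x a k =
     1 / (2 * of_real pi * \<i>) *
     vertical_integral c
       (\<lambda>s. zeta_E (1 - s) a / (2 * of_nat k * sin (of_real pi * s / (2 * of_nat k)))
            * x powr (- s))"

(* G_\<gamma>(x,a;k) = G(\<gamma> x / pi, a; k) *)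
definition scaled_kernel_G :: "real \<Rightarrow> real \<Rightarrow> complex \<Rightarrow> complex \<Rightarrow> nat \<Rightarrow> complex" where
  "scaled_kernel_G \<gamma> c x a k = kernel_G c (of_real \<gamma> * x / of_real pi) a k"

end

theory Submission
  imports Defs "HOL-Probability.Sinc_Integral" "HOL-Real_Asymp.Real_Asymp"
begin

text \<open>
  Write \<open>A = n + a\<close>, \<open>B = i + b\<close>, \<open>X = \<beta>^k A^(2k)\<close> and \<open>Y = \<alpha>^k B^(2k)\<close>. Up to the common factor
  \<open>(\<alpha>\<beta>)^(km) (-1)^(n+i) / (A B)\<close>, the terms of the double series in the second identity are
  \<open>1 / ((X + Y) X^(m-1))\<close>, \<open>1 / ((X + Y) Y^(m-1))\<close> and \<open>1 / (X^p Y^(m-p))\<close>, and the identity holds term by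
  term as a partial fraction expansion. All double series converge absolutely, because \<open>\<bar>X + Y\<bar>\<close> dominates
  \<open>n^2 + i^2\<close> and hence \<open>n i\<close>.

  The first identity reduces to the second one through
  \<open>pi G(x,a;k) = \<Sum>n. (-1)^n A^(2k-1) / (A^(2k) + x^(2k))\<close>. On the line \<open>Re s = c\<close> the function \<open>\<zeta>_E(1 - s, a)\<close>
  is given by the series of second differences of \<open>A^(s-1)\<close>, which may be integrated term by term;
  each term is an inverse Mellin transform of \<open>1 / sin\<close>, found from the residue at one pole. Summation by
  parts then removes the differences.
\<close>

section \<open>Analytic continuation of the alternating Hurwitz zeta function\<close>

text \<open>The obstacle is the line \<open>Re s = c\<close> with 1 < c < 2: there 1 - s has real
  part in (-1, 0), outside the half plane where the series of \<open>zeta_E\<close> converges. A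
  first difference of A^(s-1) has size about n^(c-2), still not summable; a second difference has
  size n^(c-3), which is. This fixes the order two.

  Interchanging sum and integral also needs the exact exponential rate in t = Im s. The cosecant
  decays only like exp(-pi |t| / (2k)), while A^(s-1) x^(-s) can grow like exp(|t| |arg x - arg A|).
  Hence the angles of all shifts of a and b must be controlled at once, and this is the origin of
  the conditions on \<open>Arg a\<close>, \<open>Arg b\<close> and their difference in front of the
  first identity. The second identity involves no integral.

  Subtracting the partial fraction 1/A from A^(2k-1) / (A^(2k) + x^(2k)) leaves the double series of
  the second identity. The split-off parts sum to \<open>zeta_E 1 a\<close> and
  \<open>zeta_E 1 b\<close>, and these supply the terms p = 0 and p = m, by which the two finite
  sums differ.\<close>

lemma nonpos_Ints_shift_nz:
  assumes "x \<notin> \<int>\<^sub>\<le>\<^sub>0"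
  shows "of_nat n + x \<noteq> 0"
  using assms by (metis add.commute eq_neg_iff_add_eq_0 minus_of_nat_in_nonpos_Ints)

text \<open>Shifting the index in the part with f (n + 1) reverses the sign and drops f 0, so the
  difference series is 2 S - f 0. On partial sums the only error is the boundary term (-1)^N f N.
  The lemma serves twice: to continue the zeta series, and later to undo the differences after
  integration.\<close>

lemma alternating_sums_difference:
  fixes f :: "nat \<Rightarrow> 'a::real_normed_field"
  assumes lim: "f \<longlonglongrightarrow> 0"
    and sums: "(\<lambda>n. (-1) ^ n * (f n - f (Suc n))) sums s"
  shows "(\<lambda>n. (-1) ^ n * f n) sums ((f 0 + s) / 2)"
proof -
  have partial: "(\<Sum>n<N. (-1) ^ n * f n)
      = (f 0 + (\<Sum>n<N. (-1) ^ n * (f n - f (Suc n))) - (-1) ^ N * f N) / 2" for N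
    by (induction N) (auto simp: field_simps)
  have "(\<lambda>N. norm ((-1) ^ N * f N)) \<longlonglongrightarrow> 0"
    using tendsto_norm[OF lim] by (simp add: norm_mult norm_power)
  hence "(\<lambda>N. (-1) ^ N * f N) \<longlonglongrightarrow> 0"
    by (rule tendsto_norm_zero_cancel)
  hence "(\<lambda>N. (f 0 + (\<Sum>n<N. (-1) ^ n * (f n - f (Suc n))) - (-1) ^ N * f N) / 2)
      \<longlonglongrightarrow> (f 0 + s - 0) / 2"
    using sums unfolding sums_def by (intro tendsto_intros) auto
  thus ?thesis
    unfolding sums_def partial by simp
qed

text \<open>Each forward difference gains a power of decay in \<open>n\<close>, so that the averaged series
  converges one unit further to the left.\<close>

primrec powr_diff :: "nat \<Rightarrow> complex \<Rightarrow> complex \<Rightarrow> complex" where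
  "powr_diff 0 w x = x powr (- w)"
| "powr_diff (Suc j) w x = powr_diff j w x - powr_diff j w (x + 1)"

text \<open>Differencing commutes with d/dx, which raises the exponent by one. This lets the mean
  value estimate of the next bound recurse from (j + 1, w) to (j, w + 1).\<close>

lemma powr_diff_has_field_derivative:
  assumes "Re x > 0"
  shows "(powr_diff j w has_field_derivative - w * powr_diff j (w + 1) x) (at x)"
  using assms
proof (induction j arbitrary: x)
  case 0
  hence "x \<notin> \<real>\<^sub>\<le>\<^sub>0"
    by (auto simp: complex_nonpos_Reals_iff)
  thus ?case
    using has_field_derivative_powr[of x "- w"] by simp
next
  case (Suc j)
  have "(powr_diff j w has_field_derivative - w * powr_diff j (w + 1) (x + 1)) (at (x + 1))"
    using Suc.prems by (intro Suc.IH) auto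
  hence "((\<lambda>x. powr_diff j w (x + 1)) has_field_derivative - w * powr_diff j (w + 1) (x + 1)) (at x)"
    by (simp add: DERIV_shift)
  with Suc.IH[OF Suc.prems] show ?case
    by (auto intro!: derivative_eq_intros simp: algebra_simps)
qed

lemma holomorphic_powr_diff:
  assumes "\<And>n. x + of_nat n \<noteq> 0"
  shows "(\<lambda>w. powr_diff j w x) holomorphic_on S"
  using assms
proof (induction j arbitrary: x)
  case 0
  from this[of 0] show ?case
    by (auto simp: powr_def intro!: holomorphic_intros)
next
  case (Suc j)
  have "x + 1 + of_nat n \<noteq> 0" for n
    using Suc.prems[of "Suc n"] by (simp add: algebra_simps)
  with Suc show ?case
    by (auto intro!: holomorphic_intros)
qed

text \<open>The mean value inequality is applied j times: the factors w, w + 1, ... collect to the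
  Pochhammer symbol, and the intermediate points stay on the segment from x to x + j. The bound B is
  left abstract because two estimates are inserted: a crude one for the continuation and one with
  sharp angles for the kernel.\<close>

lemma norm_powr_diff_le:
  assumes "Re x > 0"
    and "\<And>u. 0 \<le> u \<Longrightarrow> u \<le> real j \<Longrightarrow> norm ((x + of_real u) powr - (w + of_nat j)) \<le> B"
  shows "norm (powr_diff j w x) \<le> norm (pochhammer w j) * B"
  using assms
proof (induction j arbitrary: x w)
  case 0
  from 0(2)[of 0] show ?case by simp
next
  case (Suc j)
  have *: "norm (powr_diff j w x - powr_diff j w (x + 1))
      \<le> norm w * (norm (pochhammer (w + 1) j) * B) * norm (x - (x + 1))"
  proof (rule field_differentiable_bound)
    show "convex (closed_segment x (x + 1))" by simp
    fix z assume z: "z \<in> closed_segment x (x + 1)"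
    then obtain u where u: "0 \<le> u" "u \<le> 1" "z = x + of_real u"
      by (auto simp: closed_segment_def algebra_simps scaleR_conv_of_real)
    with Suc.prems(1) have pos: "Re z > 0" by simp
    show "(powr_diff j w has_field_derivative - w * powr_diff j (w + 1) z)
        (at z within closed_segment x (x + 1))"
      using powr_diff_has_field_derivative[OF pos] by (rule has_field_derivative_at_within)
    have "norm (powr_diff j (w + 1) z) \<le> norm (pochhammer (w + 1) j) * B"
    proof (rule Suc.IH[OF pos])
      fix v :: real assume "0 \<le> v" "v \<le> real j"
      with Suc.prems(2)[of "u + v"] u
      show "norm ((z + of_real v) powr - (w + 1 + of_nat j)) \<le> B"
        by (simp add: algebra_simps)
    qed
    thus "norm (- w * powr_diff j (w + 1) z) \<le> norm w * (norm (pochhammer (w + 1) j) * B)"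
      by (simp add: norm_mult mult_left_mono)
  qed auto
  thus ?case
    by (simp add: pochhammer_rec norm_mult mult.assoc)
qed

lemma norm_powr_shift_le:
  assumes "Re x > 0" "u \<ge> 0" "Re w \<ge> 0"
  shows "norm ((x + of_real u) powr (- w)) \<le> Re x powr (- Re w) * exp (pi * \<bar>Im w\<bar>)"
proof -
  have "Re x \<le> norm (x + of_real u)"
    using assms complex_Re_le_cmod[of "x + of_real u"] by simp
  hence "norm (x + of_real u) powr (- Re w) \<le> Re x powr (- Re w)"
    using assms by (intro powr_mono2') auto
  moreover have "Im w * Arg (x + of_real u) \<le> pi * \<bar>Im w\<bar>"
  proof -
    have "\<bar>Arg (x + of_real u)\<bar> \<le> pi"
      using Arg_bounded[of "x + of_real u"] by linarith
    hence "\<bar>Im w\<bar> * \<bar>Arg (x + of_real u)\<bar> \<le> \<bar>Im w\<bar> * pi"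
      by (intro mult_left_mono) auto
    thus ?thesis
      by (metis abs_le_D1 abs_mult mult.commute)
  qed
  ultimately show ?thesis
    unfolding norm_powr_complex by (intro mult_mono) auto
qed

lemma norm_pochhammer_le:
  fixes w :: "'a::{real_normed_field}"
  assumes "norm w \<le> R"
  shows "norm (pochhammer w j) \<le> pochhammer R j"
proof -
  have "norm (\<Prod>i<j. w + of_nat i) \<le> (\<Prod>i<j. R + real i)"
    unfolding prod_norm[symmetric]
    by (intro prod_mono) (auto intro!: order.trans[OF norm_triangle_ineq] add_mono assms)
  thus ?thesis
    by (simp add: pochhammer_prod atLeast0LessThan)
qed

text \<open>The right side depends on w only through R and the lower bound for its real part, so it
  is a Weierstrass majorant on discs. The index starts at 1 because \<open>0 powr y\<close> is
  0.\<close>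

lemma norm_alternating_powr_diff_le:
  assumes x: "Re x > 0" and w: "norm w \<le> R" "\<sigma> \<le> Re w" "\<sigma> + real j \<ge> 0" and n: "n \<ge> 1"
  shows "norm ((-1) ^ n * powr_diff j w (x + of_nat n))
    \<le> pochhammer R j * exp (pi * R) * real n powr (- (\<sigma> + real j))"
proof -
  have R: "R \<ge> 0" using w(1) norm_ge_zero order.trans by blast
  have "norm (powr_diff j w (x + of_nat n))
      \<le> norm (pochhammer w j) * (exp (pi * R) * real n powr (- (\<sigma> + real j)))"
  proof (rule norm_powr_diff_le)
    show "Re (x + of_nat n) > 0" using x by simp
    fix u :: real assume u: "0 \<le> u"
    have "norm ((x + of_nat n + of_real u) powr - (w + of_nat j))
        \<le> Re (x + of_nat n) powr (- Re (w + of_nat j)) * exp (pi * \<bar>Im (w + of_nat j)\<bar>)"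
      using x w u by (intro norm_powr_shift_le) auto
    also have "\<dots> = (Re x + real n) powr (- (Re w + real j)) * exp (pi * \<bar>Im w\<bar>)"
      by simp
    also have "\<dots> \<le> real n powr (- (\<sigma> + real j)) * exp (pi * R)"
    proof (intro mult_mono)
      have "(Re x + real n) powr (- (Re w + real j)) \<le> real n powr (- (Re w + real j))"
        using x w n by (intro powr_mono2') auto
      also have "\<dots> \<le> real n powr (- (\<sigma> + real j))"
        using w n by (intro powr_mono) auto
      finally show "(Re x + real n) powr (- (Re w + real j)) \<le> real n powr (- (\<sigma> + real j))" .
      show "exp (pi * \<bar>Im w\<bar>) \<le> exp (pi * R)"
        using abs_Im_le_cmod[of w] w(1) by (intro iffD2[OF exp_le_cancel_iff] mult_left_mono) auto
    qed auto
    finally show "norm ((x + of_nat n + of_real u) powr - (w + of_nat j))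
        \<le> exp (pi * R) * real n powr (- (\<sigma> + real j))"
      by (simp only: mult.commute)
  qed
  also have "\<dots> \<le> pochhammer R j * (exp (pi * R) * real n powr (- (\<sigma> + real j)))"
    by (intro mult_right_mono norm_pochhammer_le w) auto
  finally show ?thesis
    by (simp add: norm_mult norm_power mult.assoc)
qed

lemma summable_powr_majorant:
  assumes "\<sigma> + real j > 1"
  shows "summable (\<lambda>n. pochhammer R j * exp (pi * R) * real n powr (- (\<sigma> + real j)))"
  using assms by (intro summable_mult) (simp add: summable_real_powr_iff)

lemma summable_alternating_powr_diff:
  assumes "Re x > 0" "Re w + real j > 1"
  shows "summable (\<lambda>n. (-1) ^ n * powr_diff j w (x + of_nat n))"
proof (rule summable_comparison_test_ev)
  show "\<forall>\<^sub>F n in sequentially. norm ((-1) ^ n * powr_diff j w (x + of_nat n))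
      \<le> pochhammer (norm w) j * exp (pi * norm w) * real n powr (- (Re w + real j))"
    using eventually_ge_at_top[of 1]
    by eventually_elim (use assms in \<open>intro norm_alternating_powr_diff_le, auto\<close>)
  show "summable (\<lambda>n. pochhammer (norm w) j * exp (pi * norm w) * real n powr (- (Re w + real j)))"
    using assms by (intro summable_powr_majorant) auto
qed

text \<open>The Euler transform of the alternating series stopped after j averaging steps: j
  boundary terms plus a remainder series that converges absolutely for Re w > 1 - j.\<close>

definition eta_cont :: "nat \<Rightarrow> complex \<Rightarrow> complex \<Rightarrow> complex" where
  "eta_cont j x w = (\<Sum>i<j. powr_diff i w x / 2 ^ Suc i)
     + (\<Sum>n. (-1) ^ n * powr_diff j w (x + of_nat n)) / 2 ^ j"

lemma holomorphic_eta_cont: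
  assumes x: "Re x > 0"
  shows "eta_cont j x holomorphic_on {w. Re w > 1 - real j}"
proof -
  have nz: "x + of_nat n + of_nat m \<noteq> 0" for n m
    using x by (auto simp: complex_eq_iff)
  have "(\<lambda>w. \<Sum>n. (-1) ^ n * powr_diff j w (x + of_nat n)) holomorphic_on {w. Re w > 1 - real j}"
  proof (rule holomorphic_uniform_sequence)
    show "open {w. Re w > 1 - real j}"
      by (rule open_halfspace_Re_gt)
    show "(\<lambda>w. \<Sum>n<N. (-1) ^ n * powr_diff j w (x + of_nat n)) holomorphic_on {w. Re w > 1 - real j}" for N
      using nz by (intro holomorphic_intros holomorphic_powr_diff) auto
    fix w0 :: complex assume w0: "w0 \<in> {w. Re w > 1 - real j}"
    \<comment> \<open>Half the distance from w0 to the boundary line, so that on the closed disc the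
      decay exponent is still at least 1 + d.\<close>
    define d where "d = (Re w0 - (1 - real j)) / 2"
    have d: "d > 0" using w0 by (simp add: d_def)
    have near: "Re w0 - d \<le> Re w" "norm w \<le> norm w0 + d" if "w \<in> cball w0 d" for w
    proof -
      have "norm (w0 - w) \<le> d" using that by (simp add: dist_norm)
      thus "Re w0 - d \<le> Re w" "norm w \<le> norm w0 + d"
        using abs_Re_le_cmod[of "w0 - w"] norm_triangle_ineq4[of w0 "w0 - w"] by auto
    qed
    have "cball w0 d \<subseteq> {w. Re w > 1 - real j}"
    proof
      fix w assume "w \<in> cball w0 d"
      from near(1)[OF this] d show "w \<in> {w. Re w > 1 - real j}"
        by (simp add: d_def field_simps)
    qed
    moreover have "uniform_limit (cball w0 d) (\<lambda>N w. \<Sum>n<N. (-1) ^ n * powr_diff j w (x + of_nat n))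
        (\<lambda>w. \<Sum>n. (-1) ^ n * powr_diff j w (x + of_nat n)) sequentially"
    proof (rule Weierstrass_m_test_ev)
      have s: "Re w0 - d + real j > 1" using d by (simp add: d_def field_simps)
      show "\<forall>\<^sub>F n in sequentially. \<forall>w\<in>cball w0 d. norm ((-1) ^ n * powr_diff j w (x + of_nat n))
          \<le> pochhammer (norm w0 + d) j * exp (pi * (norm w0 + d)) * real n powr (- (Re w0 - d + real j))"
        using eventually_ge_at_top[of 1]
      proof (eventually_elim, intro ballI)
        fix n :: nat and w assume "n \<ge> 1" "w \<in> cball w0 d"
        with near[of w] x s show "norm ((-1) ^ n * powr_diff j w (x + of_nat n))
          \<le> pochhammer (norm w0 + d) j * exp (pi * (norm w0 + d)) * real n powr (- (Re w0 - d + real j))"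
          by (intro norm_alternating_powr_diff_le) auto
      qed
      show "summable (\<lambda>n. pochhammer (norm w0 + d) j * exp (pi * (norm w0 + d))
          * real n powr (- (Re w0 - d + real j)))"
        by (rule summable_powr_majorant[OF s])
    qed
    ultimately show "\<exists>d. 0 < d \<and> cball w0 d \<subseteq> {w. Re w > 1 - real j}
        \<and> uniform_limit (cball w0 d) (\<lambda>N w. \<Sum>n<N. (-1) ^ n * powr_diff j w (x + of_nat n))
        (\<lambda>w. \<Sum>n. (-1) ^ n * powr_diff j w (x + of_nat n)) sequentially"
      using d by blast
  qed
  thus ?thesis
    unfolding eta_cont_def using nz[of 0]
    by (intro holomorphic_intros holomorphic_powr_diff) auto
qed

lemma powr_diff_tendsto_0:
  assumes x: "Re x > 0" and w: "Re w + real j > 0"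
  shows "(\<lambda>n. powr_diff j w (x + of_nat n)) \<longlonglongrightarrow> 0"
proof (rule Lim_null_comparison)
  show "\<forall>\<^sub>F n in sequentially. norm (powr_diff j w (x + of_nat n))
      \<le> pochhammer (norm w) j * exp (pi * norm w) * real n powr (- (Re w + real j))"
    using eventually_ge_at_top[of 1]
  proof eventually_elim
    case (elim n)
    with norm_alternating_powr_diff_le[OF x, of w "norm w" "Re w" j n] w show ?case
      by (simp add: norm_mult norm_power)
  qed
  have "(\<lambda>n. real n powr (- (Re w + real j))) \<longlonglongrightarrow> 0"
    using w by (intro tendsto_neg_powr filterlim_real_sequentially) auto
  thus "(\<lambda>n. pochhammer (norm w) j * exp (pi * norm w) * real n powr (- (Re w + real j))) \<longlonglongrightarrow> 0"
    by (rule tendsto_mult_right_zero)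
qed

text \<open>Convergence here may be only conditional; it is inherited from the absolutely convergent
  series one difference higher. The case j = 0 identifies \<open>eta_cont 1\<close> with the
  defining series on the whole half plane Re w > 0.\<close>

lemma alternating_powr_diff_sums:
  assumes x: "Re x > 0" and w: "Re w + real j > 0"
  shows "(\<lambda>n. (-1) ^ n * powr_diff j w (x + of_nat n)) sums
    ((powr_diff j w x + (\<Sum>n. (-1) ^ n * powr_diff (Suc j) w (x + of_nat n))) / 2)"
proof -
  have "summable (\<lambda>n. (-1) ^ n * powr_diff (Suc j) w (x + of_nat n))"
    using assms by (intro summable_alternating_powr_diff) auto
  hence "(\<lambda>n. (-1) ^ n * (powr_diff j w (x + of_nat n) - powr_diff j w (x + of_nat (Suc n)))) sums
      (\<Sum>n. (-1) ^ n * powr_diff (Suc j) w (x + of_nat n))"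
    by (simp add: summable_sums add_ac)
  from alternating_sums_difference[OF powr_diff_tendsto_0[OF assms] this]
  show ?thesis by simp
qed

lemma eta_cont_Suc:
  assumes x: "Re x > 0" and w: "Re w + real j > 1"
  shows "eta_cont (Suc j) x w = eta_cont j x w"
proof -
  define T where "T i = (\<Sum>n. (-1) ^ n * powr_diff i w (x + of_nat n))" for i
  have "T j = (powr_diff j w x + T (Suc j)) / 2"
    using alternating_powr_diff_sums[of x w j] assms unfolding T_def sums_iff by auto
  moreover have "eta_cont i x w = (\<Sum>l<i. powr_diff l w x / 2 ^ Suc l) + T i / 2 ^ i" for i
    by (simp add: eta_cont_def T_def)
  ultimately show ?thesis
    by (simp add: add_divide_distrib del: powr_diff.simps)
qed

lemma eta_cont_eq:
  assumes x: "Re x > 0" and w: "Re w + real i > 1" and "i \<le> j"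
  shows "eta_cont j x w = eta_cont i x w"
  using assms(3)
proof (induction j rule: dec_induct)
  case (step j)
  thus ?case using eta_cont_Suc[OF x, of w j] w by auto
qed auto

lemma eta_cont_1_sums:
  assumes "Re x > 0" "Re w > 0"
  shows "(\<lambda>n. (-1) ^ n * (x + of_nat n) powr (- w)) sums eta_cont 1 x w"
  using alternating_powr_diff_sums[of x w 0] assms by (simp add: eta_cont_def add_divide_distrib)

section \<open>Existence and uniqueness of the entire extension\<close>

definition entire_eta :: "complex \<Rightarrow> (complex \<Rightarrow> complex) \<Rightarrow> bool" where
  "entire_eta x f \<longleftrightarrow> f holomorphic_on UNIV \<and>
     (\<forall>w. Re w > 0 \<longrightarrow> (\<lambda>n. (-1) ^ n / (of_nat n + x) powr w) sums f w)"

text \<open>Two candidates agree on the open half plane Re w > 0, hence everywhere by the identity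
  theorem. So any entire extension that is actually exhibited evaluates the definite description in
  \<open>zeta_E\<close>.\<close>

lemma zeta_E_eqI:
  assumes "entire_eta x f"
  shows "zeta_E w x = f w"
proof -
  have "g = f" if "entire_eta x g" for g
  proof
    fix z
    show "g z = f z"
    proof (rule analytic_continuation_open[of "{w. Re w > 0}" UNIV g f])
      show "{w. Re w > 0} \<noteq> {}" by (auto intro!: exI[of _ 1])
      show "open {w. Re w > 0}" by (rule open_halfspace_Re_gt)
    qed (use assms that in \<open>auto simp: entire_eta_def intro: sums_unique2\<close>)
  qed
  with assms have "(THE f. entire_eta x f) = f" by blast
  thus ?thesis by (simp add: zeta_E_def entire_eta_def)
qed

lemma entire_eta_pos:
  assumes x: "Re x > 0"
  obtains f where "entire_eta x f" "\<And>j w. Re w + real j > 1 \<Longrightarrow> f w = eta_cont j x w"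
proof -
  \<comment> \<open>Enough averaging steps to make the remainder at w converge absolutely. The level
    varies with w, but by \<open>eta_cont_eq\<close> all admissible levels agree, so near each point
    f is a single holomorphic \<open>eta_cont\<close>.\<close>
  define J where "J w = nat \<lceil>2 - Re w\<rceil>" for w
  have J: "Re w + real (J w) > 1" for w unfolding J_def by linarith
  define f where "f w = eta_cont (J w) x w" for w
  have f: "f w = eta_cont j x w" if "Re w + real j > 1" for j w
    unfolding f_def
    using eta_cont_eq[OF x that, of "max j (J w)"] eta_cont_eq[OF x J, of w "max j (J w)"] by simp
  have "f field_differentiable at w" for w
  proof -
    let ?S = "{z. Re z > 1 - real (J w)}"
    have "eta_cont (J w) x holomorphic_on ?S"
      by (rule holomorphic_eta_cont[OF x])
    hence "f holomorphic_on ?S"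
      by (rule holomorphic_transform) (auto intro!: f[symmetric])
    moreover have "open ?S" by (rule open_halfspace_Re_gt)
    moreover have "w \<in> ?S" using J[of w] by simp
    ultimately show ?thesis
      by (simp add: holomorphic_on_imp_differentiable_at)
  qed
  hence "f holomorphic_on UNIV"
    by (simp add: holomorphic_on_def)
  moreover have "(\<lambda>n. (-1) ^ n / (of_nat n + x) powr w) sums f w" if "Re w > 0" for w
    using eta_cont_1_sums[OF x that] f[of w 1] that
    by (simp add: powr_minus divide_inverse add_ac)
  ultimately show ?thesis
    using that[of f] f by (auto simp: entire_eta_def)
qed

text \<open>The difference estimates need the base point in the right half plane. Splitting off
  finitely many terms moves it there, and these terms are entire in w because no n + x
  vanishes.\<close>

lemma entire_eta_exists:
  assumes "x \<notin> \<int>\<^sub>\<le>\<^sub>0"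
  shows "\<exists>f. entire_eta x f"
proof -
  define N where "N = nat \<lceil>1 - Re x\<rceil>"
  have N: "Re (x + of_nat N) > 0" unfolding N_def by (simp; linarith)
  obtain g where g: "entire_eta (x + of_nat N) g"
    using entire_eta_pos[OF N] by blast
  note nz = nonpos_Ints_shift_nz[OF assms]
  define f where "f w = (\<Sum>n<N. (-1) ^ n / (of_nat n + x) powr w) + (-1) ^ N * g w" for w
  have "f holomorphic_on UNIV"
    unfolding f_def using g nz
    by (intro holomorphic_intros) (auto simp: entire_eta_def)
  moreover have "(\<lambda>n. (-1) ^ n / (of_nat n + x) powr w) sums f w" if w: "Re w > 0" for w
  proof -
    have "(\<lambda>n. (-1) ^ n / (of_nat n + (x + of_nat N)) powr w) sums g w"
      using g w by (auto simp: entire_eta_def)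
    hence "(\<lambda>n. (-1) ^ N * ((-1) ^ n / (of_nat n + (x + of_nat N)) powr w)) sums ((-1) ^ N * g w)"
      by (rule sums_mult)
    hence "(\<lambda>n. (-1) ^ (n + N) / (of_nat (n + N) + x) powr w) sums ((-1) ^ N * g w)"
      by (simp add: power_add add_ac mult_ac)
    thus ?thesis
      unfolding f_def by (subst (asm) sums_iff_shift) (simp add: add.commute)
  qed
  ultimately show ?thesis
    by (auto simp: entire_eta_def)
qed

lemma zeta_E_sums_powr:
  assumes "x \<notin> \<int>\<^sub>\<le>\<^sub>0" "Re w > 0"
  shows "(\<lambda>n. (-1) ^ n / (of_nat n + x) powr w) sums zeta_E w x"
proof -
  obtain f where f: "entire_eta x f" using entire_eta_exists[OF assms(1)] by blast
  with zeta_E_eqI[OF f] assms(2) show ?thesis by (simp add: entire_eta_def)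
qed

lemma zeta_E_eq_eta_cont:
  assumes "Re x > 0" "Re w + real j > 1"
  shows "zeta_E w x = eta_cont j x w"
  using entire_eta_pos[OF assms(1)] zeta_E_eqI assms(2) by metis

lemma zeta_E_sums_power:
  assumes "x \<notin> \<int>\<^sub>\<le>\<^sub>0" "q \<ge> 1"
  shows "(\<lambda>n. (-1) ^ n / (of_nat n + x) ^ q) sums zeta_E (of_nat q) x"
  using zeta_E_sums_powr[OF assms(1), of "of_nat q"] nonpos_Ints_shift_nz[OF assms(1)] assms(2)
  by simp

section \<open>An inverse Mellin transform\<close>

lemma integrable_exp_minus_abs:
  fixes d :: real
  assumes "d > 0"
  shows "integrable lborel (\<lambda>t. exp (- d * \<bar>t\<bar>))"
proof -
  define h where "h t = indicator {0<..} t *\<^sub>R exp (- (t * d))" for t :: real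
  have h: "integrable lborel h"
    using integrable_I0i_exp_mscale[OF assms] by (simp add: h_def[abs_def] set_integrable_def)
  hence "integrable lborel (\<lambda>t. h (0 + (-1) * t))"
    by (rule lborel_integrable_real_affine) simp
  with h have "integrable lborel (\<lambda>t. h t + h (- t))"
    by (intro Bochner_Integration.integrable_add) auto
  thus ?thesis
  proof (rule integrable_cong_AE_imp)
    \<comment> \<open>At 0 the two sides differ: the half-line function h vanishes there, so the
      reflected sum is 0 instead of 1.\<close>
    have "AE t in lborel. t \<noteq> (0 :: real)" by (rule AE_lborel_singleton)
    thus "AE t in lborel. h t + h (- t) = exp (- d * \<bar>t\<bar>)"
      by eventually_elim (auto simp: h_def indicator_def abs_if mult.commute)
  qed measurable
qed

text \<open>Comes from |Re (sin z)| = |sin (Re z)| cosh (Im z). It has the full exponential rate and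
  suits vertical lines, where sin (Re z) is a fixed nonzero number.\<close>

lemma norm_sin_ge_exp:
  "norm (sin z) \<ge> \<bar>sin (Re z)\<bar> * exp \<bar>Im z\<bar> / 2"
proof -
  have "\<bar>sin (Re z)\<bar> * exp \<bar>Im z\<bar> / 2 \<le> \<bar>sin (Re z)\<bar> * (exp (Im z) + exp (- Im z)) / 2"
    by (intro divide_right_mono mult_left_mono) (auto simp: abs_if)
  also have "\<dots> = \<bar>Re (sin z)\<bar>"
    by (simp add: Re_sin abs_mult add_pos_pos)
  finally show ?thesis
    using abs_Re_le_cmod[of "sin z"] by linarith
qed

text \<open>The companion for horizontal segments, on which sin (Re z) may vanish: it is uniform in
  Re z, since |sin z| is at least sinh |Im z|.\<close>

lemma norm_sin_ge_sinh:
  "norm (sin z) \<ge> (exp \<bar>Im z\<bar> - 1) / 2"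
proof (rule power2_le_imp_le)
  define E where "E = exp \<bar>Im z\<bar>"
  have E: "E \<ge> 1" by (simp add: E_def)
  have "((E - 1) / 2)\<^sup>2 \<le> ((E - inverse E) / 2)\<^sup>2"
    using E by (intro power_mono divide_right_mono diff_left_mono) (auto simp: inverse_le_1_iff)
  also have "\<dots> = (E\<^sup>2 + inverse (E\<^sup>2) - 2) / 4"
    using E by (simp add: field_simps power2_eq_square)
  also have "\<dots> \<le> (E\<^sup>2 + inverse (E\<^sup>2) - 2 * cos (2 * Re z)) / 4"
    by simp
  also have "E\<^sup>2 + inverse (E\<^sup>2) = exp (2 * Im z) + inverse (exp (2 * Im z))"
    by (auto simp: E_def abs_if exp_double[symmetric] exp_minus)
  finally show "((exp \<bar>Im z\<bar> - 1) / 2)\<^sup>2 \<le> (norm (sin z))\<^sup>2"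
    by (simp add: norm_sin_squared E_def)
qed auto

section \<open>Absolutely convergent integrals along vertical lines\<close>

lemma continuous_on_Complex_right [continuous_intros]:
  "continuous_on A (\<lambda>t. Complex c t)"
  unfolding Complex_eq by (intro continuous_intros)

lemma integrable_lborel_exp_bound:
  fixes F :: "real \<Rightarrow> complex"
  assumes "continuous_on UNIV F" "d > 0" "\<And>t. norm (F t) \<le> K * exp (- d * \<bar>t\<bar>)"
  shows "integrable lborel F"
proof (rule Bochner_Integration.integrable_bound)
  show "integrable lborel (\<lambda>t. K * exp (- d * \<bar>t\<bar>))"
    using integrable_exp_minus_abs[OF assms(2)] by simp
  show "F \<in> borel_measurable lborel"
    using borel_measurable_continuous_onI[OF assms(1)] by simp
  show "AE t in lborel. norm (F t) \<le> norm (K * exp (- d * \<bar>t\<bar>))"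
    by (intro AE_I2 order.trans[OF assms(3)]) simp
qed

lemma integral_symmetric_interval_tendsto:
  fixes F :: "real \<Rightarrow> complex"
  assumes F: "integrable lborel F"
  shows "(\<lambda>n. integral {- real n..real n} F) \<longlonglongrightarrow> (\<integral>t. F t \<partial>lborel)"
proof -
  have "(\<lambda>n. \<integral>t. indicator {- real n..real n} t *\<^sub>R F t \<partial>lborel) \<longlonglongrightarrow> (\<integral>t. F t \<partial>lborel)"
  proof (rule integral_dominated_convergence)
    show "integrable lborel (\<lambda>t. norm (F t))" using F by simp
    show "AE t in lborel. (\<lambda>n. indicator {- real n..real n} t *\<^sub>R F t) \<longlonglongrightarrow> F t"
    proof (rule AE_I2)
      fix t :: real
      have "\<forall>\<^sub>F n in sequentially. indicator {- real n..real n} t *\<^sub>R F t = F t"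
        using eventually_ge_at_top[of "nat \<lceil>\<bar>t\<bar>\<rceil>"]
        by eventually_elim (auto simp: indicator_def, (linarith+)?)
      thus "(\<lambda>n. indicator {- real n..real n} t *\<^sub>R F t) \<longlonglongrightarrow> F t"
        by (rule tendsto_eventually)
    qed
  qed (use F in \<open>auto intro!: AE_I2 simp: indicator_def\<close>)
  moreover have "(\<integral>t. indicator {- real n..real n} t *\<^sub>R F t \<partial>lborel) = integral {- real n..real n} F" for n
  proof -
    have "set_integrable lborel {- real n..real n} F"
      using F by (auto simp: set_integrable_def intro!: integrable_mult_indicator)
    from set_borel_integral_eq_integral(2)[OF this] show ?thesis
      by (simp add: set_lebesgue_integral_def)
  qed
  ultimately show ?thesis by simp
qed

text \<open>The Mellin kernel y^(-s) / sin(pi s) with L in the role of log y. Passing L itself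
  permits a difference of two logarithms without asking whether it is a principal logarithm.\<close>

definition csc_exp :: "complex \<Rightarrow> complex \<Rightarrow> complex" where
  "csc_exp L s = exp (- s * L) / sin (of_real pi * s)"

lemma sin_pi_nz:
  assumes "\<bar>Re s\<bar> < 1" "s \<noteq> 0"
  shows "sin (of_real pi * s) \<noteq> 0"
proof
  assume "sin (of_real pi * s) = 0"
  then obtain n :: int where "of_real pi * s = of_real (of_int n * pi)"
    by (auto simp: sin_eq_0)
  hence "s = of_int n" by simp
  with assms show False by simp
qed

text \<open>This quasi-periodicity makes the two vertical sides of the rectangle proportional, so that the
  residue at \<open>0\<close> determines the integral.\<close>

lemma csc_exp_shift: "csc_exp L (s - 1) = - exp L * csc_exp L s"
proof -
  have "sin (of_real pi * (s - 1)) = - sin (of_real pi * s)"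
    by (simp add: algebra_simps sin_diff)
  moreover have "exp (- (s - 1) * L) = exp L * exp (- s * L)"
    by (simp add: algebra_simps flip: exp_add)
  ultimately show ?thesis
    by (simp add: csc_exp_def)
qed

lemma norm_exp_times: "norm (exp (- s * L)) = exp (Im s * Im L - Re s * Re L)"
  by simp

lemma csc_exp_line_bound:
  assumes "0 < c" "c < 1"
  shows "norm (csc_exp L (Complex c t))
    \<le> 2 * exp (- c * Re L) / sin (pi * c) * exp (- (pi - \<bar>Im L\<bar>) * \<bar>t\<bar>)"
proof -
  have s: "sin (pi * c) > 0"
    using assms by (intro sin_gt_zero) auto
  have "sin (pi * c) * exp (pi * \<bar>t\<bar>) / 2 \<le> norm (sin (of_real pi * Complex c t))"
    using norm_sin_ge_exp[of "of_real pi * Complex c t"] s by (simp add: abs_mult)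
  hence "norm (csc_exp L (Complex c t)) \<le> exp (t * Im L - c * Re L) / (sin (pi * c) * exp (pi * \<bar>t\<bar>) / 2)"
    unfolding csc_exp_def norm_divide norm_exp_times using s
    by (intro frac_le) auto
  also have "\<dots> \<le> exp (\<bar>t\<bar> * \<bar>Im L\<bar> - c * Re L) / (sin (pi * c) * exp (pi * \<bar>t\<bar>) / 2)"
    using s abs_ge_self[of "t * Im L"] by (intro divide_right_mono) (auto simp: abs_mult)
  also have "\<dots> = 2 * exp (- c * Re L) / sin (pi * c) * exp (- (pi - \<bar>Im L\<bar>) * \<bar>t\<bar>)"
    using s by (simp add: field_simps exp_diff exp_minus flip: exp_add)
  finally show ?thesis .
qed

lemma continuous_on_csc_exp:
  assumes "\<And>s. s \<in> A \<Longrightarrow> sin (of_real pi * s) \<noteq> 0"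
  shows "continuous_on A (csc_exp L)"
  unfolding csc_exp_def using assms by (intro continuous_intros) auto

lemma continuous_on_csc_exp_line:
  assumes "0 < c" "c < 1"
  shows "continuous_on A (\<lambda>t. csc_exp L (Complex c t))"
proof -
  have "continuous_on (Complex c ` A) (csc_exp L)"
    using assms by (intro continuous_on_csc_exp sin_pi_nz) (auto simp: complex_eq_iff)
  thus ?thesis
    by (rule continuous_on_compose2) (auto intro!: continuous_intros)
qed

lemma integrable_csc_exp:
  assumes "0 < c" "c < 1" "\<bar>Im L\<bar> < pi"
  shows "integrable lborel (\<lambda>t. csc_exp L (Complex c t))"
  using integrable_lborel_exp_bound[OF continuous_on_csc_exp_line[OF assms(1,2)] _
      csc_exp_line_bound[OF assms(1,2), of L]] assms(3)
  by simp

lemma holomorphic_csc_exp: "csc_exp L holomorphic_on {s. \<bar>Re s\<bar> < 1} - {0}"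
  unfolding csc_exp_def using sin_pi_nz by (intro holomorphic_intros) auto

lemma residue_csc_exp: "residue (csc_exp L) 0 = 1 / of_real pi"
proof (rule residue_simple')
  show "open {s. \<bar>Re s\<bar> < 1}"
    by (intro open_Collect_less continuous_intros)
  show "csc_exp L holomorphic_on {s. \<bar>Re s\<bar> < 1} - {0}"
    by (rule holomorphic_csc_exp)
  have "((\<lambda>s. sin (of_real pi * s)) has_field_derivative of_real pi) (at (0 :: complex))"
    by (auto intro!: derivative_eq_intros)
  hence "((\<lambda>s. sin (of_real pi * s) / s) \<longlongrightarrow> of_real pi) (at (0 :: complex))"
    by (simp add: has_field_derivative_iff)
  moreover have "((\<lambda>s. exp (- s * L)) \<longlongrightarrow> exp (- 0 * L)) (at (0 :: complex))"
    by (intro tendsto_intros)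
  ultimately have "((\<lambda>s. exp (- s * L) / (sin (of_real pi * s) / s)) \<longlongrightarrow> exp (- 0 * L) / of_real pi) (at 0)"
    by (intro tendsto_divide) auto
  thus "((\<lambda>s. csc_exp L s * (s - 0)) \<longlongrightarrow> 1 / of_real pi) (at 0)"
    by (simp add: csc_exp_def)
qed auto

text \<open>The rectangle has width 1 and real parts from c - 1 < 0 to c > 0, so 0 is the only pole
  of the cosecant inside.\<close>

lemma csc_exp_rectangle:
  assumes c: "0 < c" "c < 1" and T: "T > 0"
  shows "contour_integral (rectpath (Complex (c - 1) (- T)) (Complex c T)) (csc_exp L) = 2 * \<i>"
proof -
  let ?S = "{s. \<bar>Re s\<bar> < 1}" and ?g = "rectpath (Complex (c - 1) (- T)) (Complex c T)"
  have img: "path_image ?g \<subseteq> ?S - {0}"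
    using c T by (subst path_image_rectpath) auto
  have S: "open ?S" by (intro open_Collect_less continuous_intros)
  have cnv: "convex ?S"
  proof -
    have "?S = {s. Re s > -1} \<inter> {s. Re s < 1}" by auto
    thus ?thesis
      by (simp only: convex_Int convex_halfspace_Re_gt convex_halfspace_Re_lt)
  qed
  have "contour_integral ?g (csc_exp L)
      = 2 * pi * \<i> * (\<Sum>p\<in>{0}. winding_number ?g p * residue (csc_exp L) p)"
  proof (rule Residue_theorem)
    show "csc_exp L holomorphic_on ?S - {0}"
      by (rule holomorphic_csc_exp)
    show "\<forall>z. z \<notin> ?S \<longrightarrow> winding_number ?g z = 0"
    proof (intro allI impI)
      fix z assume "z \<notin> ?S"
      with img cnv show "winding_number ?g z = 0"
        by (intro winding_number_zero_outside[of _ ?S]) auto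
    qed
  qed (use S img cnv in \<open>auto intro: convex_connected\<close>)
  also have "(\<Sum>p\<in>{0}. winding_number ?g p * residue (csc_exp L) p) = winding_number ?g 0 / of_real pi"
    by (simp add: residue_csc_exp)
  also have "winding_number ?g 0 = 1"
    using c T by (intro winding_number_rectpath) (auto simp: in_box_complex_iff)
  finally show ?thesis
    by (simp add: residue_csc_exp)
qed

lemma csc_exp_horizontal_bound:
  assumes T: "T > 0" and s: "\<bar>Im s\<bar> = T" "\<bar>Re s\<bar> \<le> 1"
  shows "norm (csc_exp L s) \<le> 2 * exp \<bar>Re L\<bar> * (exp (T * \<bar>Im L\<bar>) / (exp (pi * T) - 1))"
proof -
  have pos: "exp (pi * T) - 1 > 0" using T by simp
  have "(exp (pi * T) - 1) / 2 \<le> norm (sin (of_real pi * s))"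
    using norm_sin_ge_sinh[of "of_real pi * s"] s by (simp add: abs_mult)
  moreover have "Im s * Im L - Re s * Re L \<le> T * \<bar>Im L\<bar> + \<bar>Re L\<bar>"
  proof -
    have "Im s * Im L \<le> T * \<bar>Im L\<bar>"
      using abs_ge_self[of "Im s * Im L"] s by (simp add: abs_mult)
    moreover have "- (Re s * Re L) \<le> \<bar>Re s\<bar> * \<bar>Re L\<bar>"
      using abs_ge_minus_self[of "Re s * Re L"] by (simp add: abs_mult)
    moreover have "\<bar>Re s\<bar> * \<bar>Re L\<bar> \<le> 1 * \<bar>Re L\<bar>"
      using s by (intro mult_right_mono) auto
    ultimately show ?thesis by linarith
  qed
  ultimately have "norm (csc_exp L s) \<le> exp (T * \<bar>Im L\<bar> + \<bar>Re L\<bar>) / ((exp (pi * T) - 1) / 2)"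
    unfolding csc_exp_def norm_divide norm_exp_times using pos
    by (intro frac_le) auto
  also have "\<dots> = 2 * exp \<bar>Re L\<bar> * (exp (T * \<bar>Im L\<bar>) / (exp (pi * T) - 1))"
    by (simp add: exp_add)
  finally show ?thesis .
qed

text \<open>The right side of the rectangle contributes i I and, by \<open>csc_exp_shift\<close>,
  the left side contributes i exp(L) I. Against the residue value 2 i only the two horizontal sides
  remain, each of length 1 and with integrand at most B.\<close>

lemma csc_exp_truncated:
  assumes c: "0 < c" "c < 1" and T: "T > 0"
  shows "norm ((1 + exp L) * integral {- T..T} (\<lambda>t. csc_exp L (Complex c t)) - 2)
    \<le> 4 * exp \<bar>Re L\<bar> * (exp (T * \<bar>Im L\<bar>) / (exp (pi * T) - 1))"
proof -
  define B where "B = 2 * exp \<bar>Re L\<bar> * (exp (T * \<bar>Im L\<bar>) / (exp (pi * T) - 1))"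
  define a1 a2 a3 a4 where "a1 = Complex (c - 1) (- T)" and "a2 = Complex c (- T)"
    and "a3 = Complex c T" and "a4 = Complex (c - 1) T"
  note a_defs = a1_def a2_def a3_def a4_def
  let ?f = "csc_exp L"
  have ne: "sin (of_real pi * s) \<noteq> 0" if "s \<in> path_image (rectpath a1 a3)" for s
    using that c T unfolding a_defs by (intro sin_pi_nz) (auto simp: path_image_rectpath)
  have img: "path_image (rectpath a1 a3) = closed_segment a1 a2 \<union> closed_segment a2 a3 \<union>
      closed_segment a3 a4 \<union> closed_segment a4 a1"
    by (simp add: rectpath_def Let_def path_image_join a_defs Un_assoc)
  have int: "?f contour_integrable_on linepath a1 a2" "?f contour_integrable_on linepath a2 a3"
    "?f contour_integrable_on linepath a3 a4" "?f contour_integrable_on linepath a4 a1"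
    using ne unfolding img
    by (intro contour_integrable_continuous_linepath continuous_on_csc_exp; blast)+
  define I where "I = integral {- T..T} (\<lambda>t. ?f (Complex c t))"
  have "contour_integral (rectpath a1 a3) ?f = contour_integral (linepath a1 a2) ?f
      + contour_integral (linepath a2 a3) ?f + contour_integral (linepath a3 a4) ?f
      + contour_integral (linepath a4 a1) ?f"
  proof -
    have "Complex (Re a3) (Im a1) = a2" "Complex (Re a1) (Im a3) = a4"
      by (simp_all add: a_defs)
    thus ?thesis using int by (simp add: rectpath_def Let_def)
  qed
  also have "contour_integral (rectpath a1 a3) ?f = 2 * \<i>"
    unfolding a_defs by (rule csc_exp_rectangle[OF assms])
  also have "contour_integral (linepath a2 a3) ?f = \<i> * I"
    unfolding I_def by (rule contour_integral_linepath_same_Re) (use T in \<open>auto simp: a_defs\<close>)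
  also have "contour_integral (linepath a4 a1) ?f = - contour_integral (linepath a1 a4) ?f"
    using int(4) contour_integrable_reversepath[of "linepath a4 a1" ?f]
      contour_integral_reversepath[of "linepath a4 a1" ?f] by simp
  also have "contour_integral (linepath a1 a4) ?f = \<i> * integral {- T..T} (\<lambda>t. ?f (Complex (c - 1) t))"
    by (rule contour_integral_linepath_same_Re) (use T in \<open>auto simp: a_defs\<close>)
  also have "(\<lambda>t. ?f (Complex (c - 1) t)) = (\<lambda>t. - exp L * ?f (Complex c t))"
  proof
    fix t
    have "Complex (c - 1) t = Complex c t - 1" by (simp add: complex_eq_iff)
    thus "?f (Complex (c - 1) t) = - exp L * ?f (Complex c t)"
      by (simp only: csc_exp_shift)
  qed
  also have "integral {- T..T} (\<lambda>t. - exp L * ?f (Complex c t)) = - exp L * I"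
    unfolding I_def by (rule integral_mult_right)
  finally have "(1 + exp L) * I - 2
      = \<i> * (contour_integral (linepath a1 a2) ?f + contour_integral (linepath a3 a4) ?f)"
    by (simp add: complex_eq_iff algebra_simps)
  moreover have "norm (contour_integral (linepath a1 a2) ?f) \<le> B * norm (a2 - a1)"
  proof (rule contour_integral_bound_linepath[OF int(1)])
    fix s assume "s \<in> closed_segment a1 a2"
    thus "norm (?f s) \<le> B"
      unfolding B_def using c T
      by (intro csc_exp_horizontal_bound) (auto simp: a_defs closed_segment_same_Im closed_segment_eq_real_ivl)
  qed (use T in \<open>auto simp: B_def\<close>)
  moreover have "norm (contour_integral (linepath a3 a4) ?f) \<le> B * norm (a4 - a3)"
  proof (rule contour_integral_bound_linepath[OF int(3)])
    fix s assume "s \<in> closed_segment a3 a4"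
    thus "norm (?f s) \<le> B"
      unfolding B_def using c T
      by (intro csc_exp_horizontal_bound) (auto simp: a_defs closed_segment_same_Im closed_segment_eq_real_ivl)
  qed (use T in \<open>auto simp: B_def\<close>)
  moreover have "norm (a2 - a1) = 1" "norm (a4 - a3) = 1"
    by (auto simp: a_defs norm_complex_def)
  ultimately have "norm ((1 + exp L) * I - 2) \<le> B + B"
    using norm_triangle_ineq[of "contour_integral (linepath a1 a2) ?f" "contour_integral (linepath a3 a4) ?f"]
    by (simp add: norm_mult)
  thus ?thesis
    by (simp add: I_def B_def)
qed

lemma one_plus_exp_nz:
  assumes "\<bar>Im L\<bar> < pi"
  shows "1 + exp L \<noteq> 0"
proof
  assume "1 + exp L = 0"
  hence e: "exp L = - 1" by (simp add: eq_neg_iff_add_eq_0 add.commute)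
  have "Ln (exp L) = L" using assms by (intro Ln_exp) auto
  hence "L = \<i> * of_real pi" by (simp add: e)
  with assms show False by simp
qed

lemma integral_csc_exp:
  assumes c: "0 < c" "c < 1" and L: "\<bar>Im L\<bar> < pi"
  shows "(\<integral>t. csc_exp L (Complex c t) \<partial>lborel) = 2 / (1 + exp L)"
proof -
  let ?I = "\<lambda>T. integral {- T..T} (\<lambda>t. csc_exp L (Complex c t))"
  have "(\<lambda>n. (1 + exp L) * ?I (real n) - 2) \<longlonglongrightarrow> 0"
  proof (rule Lim_null_comparison)
    show "\<forall>\<^sub>F n in sequentially. norm ((1 + exp L) * ?I (real n) - 2)
        \<le> 4 * exp \<bar>Re L\<bar> * (exp (real n * \<bar>Im L\<bar>) / (exp (pi * real n) - 1))"
      using eventually_gt_at_top[of 0]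
      by eventually_elim (use c in \<open>intro csc_exp_truncated, auto\<close>)
    have "((\<lambda>T::real. exp (T * \<bar>Im L\<bar>) / (exp (pi * T) - 1)) \<longlongrightarrow> 0) at_top"
    proof -
      \<comment> \<open>The gap between the decay of the cosecant and the growth of the exponential.
        Cancelling exp(pi T) leaves a quotient whose limit depends only on d > 0.\<close>
      define d where "d = pi - \<bar>Im L\<bar>"
      have d: "d > 0" using L by (simp add: d_def)
      have "((\<lambda>T::real. exp (- d * T) / (1 - exp (- pi * T))) \<longlongrightarrow> 0) at_top"
        using d by real_asymp
      moreover have "exp (- d * T) / (1 - exp (- pi * T)) = exp (T * \<bar>Im L\<bar>) / (exp (pi * T) - 1)" for T
      proof -
        have "exp (- d * T) / (1 - exp (- pi * T))
            = (exp (pi * T) * exp (- d * T)) / (exp (pi * T) * (1 - exp (- pi * T)))"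
          by simp
        also have "exp (pi * T) * exp (- d * T) = exp (T * \<bar>Im L\<bar>)"
          by (simp add: d_def algebra_simps flip: exp_add)
        also have "exp (pi * T) * (1 - exp (- pi * T)) = exp (pi * T) - 1"
          by (simp add: algebra_simps flip: exp_add)
        finally show ?thesis .
      qed
      ultimately show ?thesis by simp
    qed
    hence "(\<lambda>n. exp (real n * \<bar>Im L\<bar>) / (exp (pi * real n) - 1)) \<longlonglongrightarrow> 0"
      by (rule filterlim_compose) (rule filterlim_real_sequentially)
    thus "(\<lambda>n. 4 * exp \<bar>Re L\<bar> * (exp (real n * \<bar>Im L\<bar>) / (exp (pi * real n) - 1))) \<longlonglongrightarrow> 0"
      by (rule tendsto_mult_right_zero)
  qed
  moreover have "(\<lambda>n. (1 + exp L) * ?I (real n) - 2)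
      \<longlonglongrightarrow> (1 + exp L) * (\<integral>t. csc_exp L (Complex c t) \<partial>lborel) - 2"
    using assms by (intro tendsto_intros integral_symmetric_interval_tendsto integrable_csc_exp)
  ultimately have "(1 + exp L) * (\<integral>t. csc_exp L (Complex c t) \<partial>lborel) - 2 = 0"
    using LIMSEQ_unique by blast
  with one_plus_exp_nz[OF L] show ?thesis
    by (simp add: field_simps)
qed

text \<open>Substituting s / N for s stretches the admissible strip to 0 < c < N and narrows the
  admissible angle to pi / N. With N = 2k this is where the angle pi / (2k) comes from.\<close>

lemma integral_csc_exp_scaled:
  assumes N: "N > 0" and c: "0 < c" "c < N" and M: "\<bar>Im M\<bar> < pi / N"
  defines "F \<equiv> \<lambda>t. exp (- Complex c t * M) / (of_real N * sin (of_real pi * Complex c t / of_real N))"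
  shows "integrable lborel F" and "(\<integral>t. F t \<partial>lborel) = 2 / (1 + exp (of_real N * M))"
proof -
  define L where "L = of_real N * M"
  have L: "\<bar>Im L\<bar> < pi" using M N by (simp add: L_def abs_mult field_simps)
  have c': "0 < c / N" "c / N < 1" using c N by auto
  have F: "F t = csc_exp L (Complex (c / N) (0 + (1 / N) * t)) / of_real N" for t
  proof -
    have "Complex (c / N) (0 + (1 / N) * t) = Complex c t / of_real N"
      using N by (simp add: complex_eq_iff)
    thus ?thesis using N
      by (simp add: F_def csc_exp_def L_def)
  qed
  have "integrable lborel (\<lambda>t. csc_exp L (Complex (c / N) (0 + (1 / N) * t)))"
    using N by (intro lborel_integrable_real_affine integrable_csc_exp[OF c' L]) auto
  thus "integrable lborel F" unfolding F by simp
  have "2 / (1 + exp L) = \<bar>1 / N\<bar> *\<^sub>R (\<integral>t. csc_exp L (Complex (c / N) (0 + (1 / N) * t)) \<partial>lborel)"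
    using N by (subst lborel_integral_real_affine[symmetric]) (auto simp: integral_csc_exp[OF c' L])
  also have "\<dots> = (\<integral>t. F t \<partial>lborel)"
    using N by (simp add: F scaleR_conv_of_real)
  finally show "(\<integral>t. F t \<partial>lborel) = 2 / (1 + exp (of_real N * M))"
    by (simp add: L_def)
qed

section \<open>The series of the kernel\<close>

lemma norm_powr_exp_Arg:
  assumes "z \<noteq> 0"
  shows "norm (z powr w) = norm z powr Re w * exp (- Im w * Im (Ln z))"
  using assms by (simp add: norm_powr_complex Arg_eq_Im_Ln)

lemma integral_sums_dominated:
  fixes f :: "nat \<Rightarrow> 'a \<Rightarrow> 'b::{banach, second_countable_topology}"
  assumes f: "\<And>n. integrable M (f n)" and w: "integrable M w" and K: "summable K"
    and bound: "\<And>n t. norm (f n t) \<le> K n * w t"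
  shows "integrable M (\<lambda>t. \<Sum>n. f n t)"
    and "(\<lambda>n. integral\<^sup>L M (f n)) sums (\<integral>t. (\<Sum>n. f n t) \<partial>M)"
proof -
  have 1: "AE t in M. summable (\<lambda>n. norm (f n t))"
    using bound by (intro AE_I2 summable_comparison_test'[OF summable_mult2[OF K]]) auto
  have 2: "summable (\<lambda>n. \<integral>t. norm (f n t) \<partial>M)"
  proof (rule summable_comparison_test')
    show "summable (\<lambda>n. K n * integral\<^sup>L M w)" by (rule summable_mult2[OF K])
    fix n :: nat
    have "(\<integral>t. norm (f n t) \<partial>M) \<le> (\<integral>t. K n * w t \<partial>M)"
      using f w bound by (intro integral_mono) auto
    thus "norm (\<integral>t. norm (f n t) \<partial>M) \<le> K n * integral\<^sup>L M w"
      by (simp add: integral_nonneg_AE)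
  qed
  show "integrable M (\<lambda>t. \<Sum>n. f n t)" by (rule integrable_suminf[OF f 1 2])
  show "(\<lambda>n. integral\<^sup>L M (f n)) sums (\<integral>t. (\<Sum>n. f n t) \<partial>M)" by (rule sums_integral[OF f 1 2])
qed

text \<open>Absorbs the quadratic growth of the Pochhammer factor into an arbitrarily small
  exponential rate d. The constant p + 2/d makes the linear bound (p + 2/d)(1 + d y / 2) exceed p +
  y, after which 1 + u <= exp u applies.\<close>

lemma square_le_exp:
  fixes d p y :: real
  assumes "d > 0" "p \<ge> 0" "y \<ge> 0"
  shows "(p + y)\<^sup>2 \<le> (p + 2 / d)\<^sup>2 * exp (d * y)"
proof -
  have "p + y \<le> (p + 2 / d) * (1 + d * y / 2)"
    using assms by (simp add: field_simps)
  also have "\<dots> \<le> (p + 2 / d) * exp (d * y / 2)"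
    using assms by (intro mult_left_mono exp_ge_add_one_self) auto
  finally have "(p + y)\<^sup>2 \<le> ((p + 2 / d) * exp (d * y / 2))\<^sup>2"
    using assms by (intro power_mono) auto
  also have "\<dots> = (p + 2 / d)\<^sup>2 * exp (d * y)"
    by (simp add: power_mult_distrib flip: exp_double)
  finally show ?thesis .
qed

lemma inverse_shift_tendsto_0:
  fixes a :: complex
  shows "(\<lambda>n. inverse (a + of_nat n)) \<longlonglongrightarrow> 0"
  by (intro tendsto_compose_filtermap tendsto_inverse_0
      filterlim_compose[OF tendsto_inverse_0] tendsto_add_filterlim_at_infinity[OF tendsto_const] tendsto_of_nat)

text \<open>The crude angle bound pi of the continuation would overwhelm the cosecant. Therefore the
  factor exp(t Im (Ln x)) coming from x^(-s) is estimated together with the difference, and only the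
  angle between x and the shifts of a enters the rate.\<close>

lemma norm_second_powr_diff_le:
  assumes a: "Re a > 0" and c: "1 < c" "c < 2" and d: "d > 0"
    and ang: "\<And>r. r \<ge> 0 \<Longrightarrow> \<bar>Im (Ln x) - Im (Ln (a + of_real r))\<bar> \<le> \<theta>"
  shows "norm (powr_diff 2 (1 - Complex c t) (a + of_nat n)) * exp (t * Im (Ln x))
    \<le> (4 + 2 / d)\<^sup>2 * exp ((d + \<theta>) * \<bar>t\<bar>) * (Re a + real n) powr (c - 3)"
proof -
  let ?w = "1 - Complex c t"
  have "norm (powr_diff 2 ?w (a + of_nat n))
      \<le> norm (pochhammer ?w 2) * ((Re a + real n) powr (c - 3) * exp (\<theta> * \<bar>t\<bar> - t * Im (Ln x)))"
  proof (rule norm_powr_diff_le)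
    fix u :: real assume u: "0 \<le> u"
    let ?z = "a + of_nat n + of_real u"
    have Re: "Re ?z > 0" using a u by simp
    hence "?z \<noteq> 0" by (metis less_irrefl zero_complex.sel(1))
    hence "norm (?z powr - (?w + of_nat 2)) = norm ?z powr (c - 3) * exp (- t * Im (Ln ?z))"
      by (simp add: norm_powr_exp_Arg)
    also have "\<dots> \<le> (Re a + real n) powr (c - 3) * exp (\<theta> * \<bar>t\<bar> - t * Im (Ln x))"
    proof (intro mult_mono)
      show "norm ?z powr (c - 3) \<le> (Re a + real n) powr (c - 3)"
        using a u c complex_Re_le_cmod[of ?z] by (intro powr_mono2') auto
      have "t * (Im (Ln x) - Im (Ln ?z)) \<le> \<bar>t\<bar> * \<bar>Im (Ln x) - Im (Ln ?z)\<bar>"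
        by (metis abs_ge_self abs_mult)
      also have "\<dots> \<le> \<bar>t\<bar> * \<theta>"
        using ang[of "real n + u"] u by (intro mult_left_mono) (auto simp: add_ac)
      finally show "exp (- t * Im (Ln ?z)) \<le> exp (\<theta> * \<bar>t\<bar> - t * Im (Ln x))"
        by (simp add: algebra_simps)
    qed auto
    finally show "norm (?z powr - (?w + of_nat 2))
        \<le> (Re a + real n) powr (c - 3) * exp (\<theta> * \<bar>t\<bar> - t * Im (Ln x))" .
  qed (use a in auto)
  also have "norm (pochhammer ?w 2) \<le> (4 + 2 / d)\<^sup>2 * exp (d * \<bar>t\<bar>)"
  proof -
    have "norm (pochhammer ?w 2) = norm ?w * norm (?w + 1)"
      by (simp add: numeral_2_eq_2 pochhammer_Suc norm_mult)
    also have "\<dots> \<le> (4 + \<bar>t\<bar>) * (4 + \<bar>t\<bar>)"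
    proof (intro mult_mono)
      show "norm ?w \<le> 4 + \<bar>t\<bar>" "norm (?w + 1) \<le> 4 + \<bar>t\<bar>"
        using c cmod_le[of ?w] cmod_le[of "?w + 1"] by auto
    qed auto
    also have "\<dots> \<le> (4 + 2 / d)\<^sup>2 * exp (d * \<bar>t\<bar>)"
      using square_le_exp[of d 4 "\<bar>t\<bar>"] d by (simp add: power2_eq_square)
    finally show ?thesis .
  qed
  finally have "norm (powr_diff 2 ?w (a + of_nat n)) * exp (t * Im (Ln x))
      \<le> ((4 + 2 / d)\<^sup>2 * exp (d * \<bar>t\<bar>)
         * ((Re a + real n) powr (c - 3) * exp (\<theta> * \<bar>t\<bar> - t * Im (Ln x)))) * exp (t * Im (Ln x))"
    by (intro mult_right_mono) (auto simp: mult_right_mono)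
  also have "\<dots> = (4 + 2 / d)\<^sup>2 * exp ((d + \<theta>) * \<bar>t\<bar>) * (Re a + real n) powr (c - 3)"
    by (simp add: exp_diff exp_add ring_distribs)
  finally show ?thesis .
qed

text \<open>The parameter \<open>\<theta>\<close> measures how far the growth \<open>exp (\<theta> * \<bar>t\<bar>)\<close> of the numerators stays below the decay
  \<open>exp (- pi * \<bar>t\<bar> / (2 * k))\<close> of the cosecant, uniformly in the summation index.\<close>

locale kernel_params =
  fixes c :: real and x a :: complex and k :: nat and \<theta> :: real
  assumes c: "1 < c" "c < 2" and k: "k \<ge> 1" and x: "x \<noteq> 0" and a: "Re a > 0"
    and \<theta>: "\<theta> < pi / (2 * real k)"
    and ang: "\<And>r. r \<ge> 0 \<Longrightarrow> \<bar>Im (Ln x) - Im (Ln (a + of_real r))\<bar> \<le> \<theta>"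
begin

abbreviation s :: "real \<Rightarrow> complex" where "s t \<equiv> Complex c t"

definition csc :: "real \<Rightarrow> complex" where
  "csc t = 1 / (2 * of_nat k * sin (of_real pi * s t / (2 * of_nat k)))"

text \<open>The share of the n-th summand in the kernel integrand at difference order j. Each one is
  integrable by itself; only the sum over n requires j = 2.\<close>

definition F :: "nat \<Rightarrow> nat \<Rightarrow> real \<Rightarrow> complex" where
  "F j n t = powr_diff j (1 - s t) (a + of_nat n) * (x powr (- s t) * csc t)"

lemma F_Suc: "F (Suc j) n t = F j n t - F j (Suc n) t"
  by (simp add: F_def algebra_simps)

lemma shift_nz: "a + of_nat n \<noteq> 0"
  using a by (auto simp: complex_eq_iff)

text \<open>With M = Ln x - Ln z the integrand is exp(-s M) / z times the cosecant, so the scaled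
  transform applies directly. The branch of M disappears in exp(2k M) = (x/z)^(2k).\<close>

lemma F_0:
  shows "integrable lborel (F 0 n)"
    and "(\<integral>t. F 0 n t \<partial>lborel) = 2 / ((a + of_nat n) * (1 + (x / (a + of_nat n)) ^ (2 * k)))"
proof -
  define z where "z = a + of_nat n"
  define M where "M = Ln x - Ln z"
  have z: "z \<noteq> 0" by (simp add: z_def shift_nz)
  have M: "\<bar>Im M\<bar> < pi / real (2 * k)"
    using ang[of "real n"] \<theta> by (simp add: M_def z_def)
  have N: "real (2 * k) > 0" "0 < c" "c < real (2 * k)" using k c by auto
  define G where "G t = exp (- s t * M) / (of_real (real (2 * k)) * sin (of_real pi * s t / of_real (real (2 * k))))" for t
  have F: "F 0 n = (\<lambda>t. inverse z * G t)"
  proof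
    fix t
    have "z powr (s t - 1) * x powr (- s t) = exp (- s t * M) * exp (- Ln z)"
      using x z by (simp add: powr_def M_def algebra_simps flip: exp_add)
    also have "exp (- Ln z) = inverse z"
      using z by (simp add: exp_minus)
    finally show "F 0 n t = inverse z * G t"
      by (simp add: F_def csc_def G_def z_def)
  qed
  note I = integral_csc_exp_scaled[OF N M, folded G_def]
  from I(1) show "integrable lborel (F 0 n)" unfolding F by simp
  have "exp (of_real (real (2 * k)) * M) = (x / z) ^ (2 * k)"
    using x z exp_of_nat_mult[of "2 * k" M] by (simp add: M_def exp_diff)
  with I(2) show "(\<integral>t. F 0 n t \<partial>lborel) = 2 / ((a + of_nat n) * (1 + (x / (a + of_nat n)) ^ (2 * k)))"
    unfolding F by (simp add: z_def field_simps)
qed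

lemma integrable_F: "integrable lborel (F j n)"
proof (induction j arbitrary: n)
  case (Suc j)
  have "F (Suc j) n = (\<lambda>t. F j n t - F j (Suc n) t)" by (simp add: F_Suc fun_eq_iff)
  with Suc show ?case by simp
qed (rule F_0)

definition J :: "nat \<Rightarrow> nat \<Rightarrow> complex" where
  "J j n = (\<integral>t. F j n t \<partial>lborel)"

lemma J_Suc: "J (Suc j) n = J j n - J j (Suc n)"
  using integrable_F by (simp add: J_def F_Suc)

lemma J_0_tendsto: "J 0 \<longlonglongrightarrow> 0"
proof -
  have "(\<lambda>n. 2 * inverse (a + of_nat n) / (1 + (x * inverse (a + of_nat n)) ^ (2 * k)))
      \<longlonglongrightarrow> 2 * 0 / (1 + (x * 0) ^ (2 * k))"
    using k by (intro tendsto_intros inverse_shift_tendsto_0) (auto simp: power_0_left)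
  thus ?thesis
    using k by (simp add: J_def[abs_def] F_0(2) divide_inverse mult_ac)
qed

lemma sin_abscissa_pos: "sin (pi * c / (2 * real k)) > 0"
  using c k by (intro sin_gt_zero) (auto simp: field_simps)

lemma norm_csc_le:
  "norm (csc t) \<le> 1 / (real k * sin (pi * c / (2 * real k))) * exp (- pi / (2 * real k) * \<bar>t\<bar>)"
proof -
  note sn = sin_abscissa_pos
  let ?z = "of_real pi * s t / (2 * of_nat k) :: complex"
  have z: "?z = Complex (pi * c / (2 * real k)) (pi * t / (2 * real k))"
    using k by (simp add: complex_eq_iff Re_divide Im_divide power2_eq_square)
  have "sin (pi * c / (2 * real k)) * exp (pi * \<bar>t\<bar> / (2 * real k)) / 2 \<le> norm (sin ?z)"
    using norm_sin_ge_exp[of ?z] sn unfolding z by (simp add: abs_mult)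
  hence "norm (csc t) \<le> 1 / (2 * real k * (sin (pi * c / (2 * real k)) * exp (pi * \<bar>t\<bar> / (2 * real k)) / 2))"
    unfolding csc_def norm_divide norm_mult using sn k
    by (intro frac_le mult_pos_pos) (auto intro!: mult_left_mono)
  also have "\<dots> = 1 / (real k * sin (pi * c / (2 * real k))) * exp (- pi / (2 * real k) * \<bar>t\<bar>)"
    by (simp add: exp_minus field_simps)
  finally show "norm (csc t) \<le> 1 / (real k * sin (pi * c / (2 * real k))) * exp (- pi / (2 * real k) * \<bar>t\<bar>)" .
qed

lemma norm_F_2_le:
  assumes d: "d > 0"
  shows "norm (F 2 n t) \<le> (4 + 2 / d)\<^sup>2 * norm x powr - c / (real k * sin (pi * c / (2 * real k)))
    * (Re a + real n) powr (c - 3) * exp (- (pi / (2 * real k) - \<theta> - d) * \<bar>t\<bar>)"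
proof -
  define Q where "Q = real k * sin (pi * c / (2 * real k))"
  have Q: "Q > 0" using k sin_abscissa_pos by (simp add: Q_def)
  have "norm (F 2 n t) = (norm (powr_diff 2 (1 - s t) (a + of_nat n)) * exp (t * Im (Ln x)))
      * (norm x powr - c * norm (csc t))"
    unfolding F_def norm_mult norm_powr_exp_Arg[OF x] by simp
  also have "\<dots> \<le> ((4 + 2 / d)\<^sup>2 * exp ((d + \<theta>) * \<bar>t\<bar>) * (Re a + real n) powr (c - 3))
      * (norm x powr - c * (1 / Q * exp (- pi / (2 * real k) * \<bar>t\<bar>)))"
    using norm_csc_le[of t] unfolding Q_def
    by (intro mult_mono norm_second_powr_diff_le[OF a c d ang]) auto
  also have "\<dots> = (4 + 2 / d)\<^sup>2 * norm x powr - c / Q * (Re a + real n) powr (c - 3)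
      * (exp ((d + \<theta>) * \<bar>t\<bar>) * exp (- pi / (2 * real k) * \<bar>t\<bar>))"
    by simp
  also have "exp ((d + \<theta>) * \<bar>t\<bar>) * exp (- pi / (2 * real k) * \<bar>t\<bar>)
      = exp (- (pi / (2 * real k) - \<theta> - d) * \<bar>t\<bar>)"
    by (simp add: algebra_simps flip: exp_add)
  finally show ?thesis by (simp add: Q_def)
qed

lemma F_2_sums:
  shows "integrable lborel (\<lambda>t. \<Sum>n. (-1) ^ n * F 2 n t)"
    and "(\<lambda>n. (-1) ^ n * J 2 n) sums (\<integral>t. (\<Sum>n. (-1) ^ n * F 2 n t) \<partial>lborel)"
proof -
  \<comment> \<open>Half of the angular gap: one half pays for the polynomial factor, the other half
    remains as decay in t.\<close>
  define d where "d = (pi / (2 * real k) - \<theta>) / 2"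
  have d: "d > 0" using \<theta> by (simp add: d_def)
  define C where "C = (4 + 2 / d)\<^sup>2 * norm x powr - c / (real k * sin (pi * c / (2 * real k)))"
  have dd: "pi / (2 * real k) - \<theta> - d = d" by (simp add: d_def field_simps)
  have "summable (\<lambda>n. (Re a + real n) powr (c - 3))"
  proof (rule summable_comparison_test_ev)
    show "\<forall>\<^sub>F n in sequentially. norm ((Re a + real n) powr (c - 3)) \<le> real n powr (c - 3)"
      using eventually_gt_at_top[of 0]
      by eventually_elim (use a c in \<open>auto intro!: powr_mono2'\<close>)
    show "summable (\<lambda>n. real n powr (c - 3))"
      using c by (simp add: summable_real_powr_iff)
  qed
  hence K: "summable (\<lambda>n. C * (Re a + real n) powr (c - 3))"
    by (rule summable_mult)
  have bound: "norm ((-1) ^ n * F 2 n t) \<le> C * (Re a + real n) powr (c - 3) * exp (- d * \<bar>t\<bar>)" for n t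
    using norm_F_2_le[OF d, of n t] unfolding dd C_def by (simp add: norm_mult norm_power)
  have int: "integrable lborel (\<lambda>t. (-1) ^ n * F 2 n t)" for n
    using integrable_F by simp
  note I = integral_sums_dominated[OF int integrable_exp_minus_abs[OF d] K bound]
  show "integrable lborel (\<lambda>t. \<Sum>n. (-1) ^ n * F 2 n t)" by (rule I(1))
  show "(\<lambda>n. (-1) ^ n * J 2 n) sums (\<integral>t. (\<Sum>n. (-1) ^ n * F 2 n t) \<partial>lborel)"
    using I(2) by (simp add: J_def)
qed

text \<open>This is \<open>eta_cont\<close> at level 2, available because Re (1 - s) + 2 = 3 - c >
  1. The weights 1/2, 1/4, 1/4 are those of its two boundary terms and its remainder.\<close>

lemma kernel_integrand:
  "zeta_E (1 - s t) a / (2 * of_nat k * sin (of_real pi * s t / (2 * of_nat k))) * x powr (- s t)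
    = F 0 0 t / 2 + F 1 0 t / 4 + (\<Sum>n. (-1) ^ n * F 2 n t) / 4"
proof -
  define P where "P n = (-1) ^ n * powr_diff 2 (1 - s t) (a + of_nat n)" for n
  have "summable P"
    unfolding P_def using a c by (intro summable_alternating_powr_diff) auto
  hence "(\<Sum>n. P n * (x powr (- s t) * csc t)) = suminf P * (x powr (- s t) * csc t)"
    by (rule suminf_mult2[symmetric])
  moreover have "zeta_E (1 - s t) a = powr_diff 0 (1 - s t) a / 2 + powr_diff 1 (1 - s t) a / 4 + suminf P / 4"
    using a c by (subst zeta_E_eq_eta_cont[of _ _ 2]) (auto simp: eta_cont_def P_def[abs_def] numeral_2_eq_2 simp del: powr_diff.simps)
  ultimately show ?thesis
    by (simp add: F_def P_def csc_def algebra_simps add_divide_distrib)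
qed

text \<open>Applying \<open>alternating_sums_difference\<close> twice to the integrated values J
  reproduces the weights 1/2, 1/4, 1/4 of the integrand, so the Euler transform is undone after
  integration. The factor i of the upward line cancels against 2 pi i, so the integral is 2 pi G;
  the 2 in \<open>F_0\<close> then leaves pi G.\<close>

lemma kernel_sums:
  "(\<lambda>n. (-1) ^ n * (a + of_nat n) ^ (2 * k - 1) / ((a + of_nat n) ^ (2 * k) + x ^ (2 * k)))
    sums (of_real pi * kernel_G c x a k)"
proof -
  let ?I = "\<integral>t. (\<Sum>n. (-1) ^ n * F 2 n t) \<partial>lborel"
  have "(\<lambda>n. (-1) ^ n * (J 1 n - J 1 (Suc n))) sums ?I"
    using F_2_sums(2) by (simp add: numeral_2_eq_2 J_Suc)
  moreover have "J 1 \<longlonglongrightarrow> 0"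
    using tendsto_diff[OF J_0_tendsto LIMSEQ_Suc[OF J_0_tendsto]] by (simp add: J_Suc[abs_def])
  ultimately have "(\<lambda>n. (-1) ^ n * J 1 n) sums ((J 1 0 + ?I) / 2)"
    by (intro alternating_sums_difference)
  hence "(\<lambda>n. (-1) ^ n * (J 0 n - J 0 (Suc n))) sums ((J 1 0 + ?I) / 2)"
    by (simp add: J_Suc)
  from alternating_sums_difference[OF J_0_tendsto this]
  have "(\<lambda>n. (-1) ^ n * J 0 n) sums (J 0 0 / 2 + J 1 0 / 4 + ?I / 4)"
    by (simp add: add_divide_distrib add.assoc)
  also have "J 0 0 / 2 + J 1 0 / 4 + ?I / 4
      = (\<integral>t. F 0 0 t / 2 + F 1 0 t / 4 + (\<Sum>n. (-1) ^ n * F 2 n t) / 4 \<partial>lborel)"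
    using integrable_F F_2_sums(1) by (simp add: J_def)
  also have "\<dots> = 2 * of_real pi * kernel_G c x a k"
    unfolding kernel_integrand[symmetric] by (simp add: kernel_G_def vertical_integral_def)
  finally have "(\<lambda>n. (-1) ^ n * J 0 n / 2) sums (2 * of_real pi * kernel_G c x a k / 2)"
    by (rule sums_divide)
  moreover have "(-1) ^ n * J 0 n / 2
      = (-1) ^ n * (a + of_nat n) ^ (2 * k - 1) / ((a + of_nat n) ^ (2 * k) + x ^ (2 * k))" for n
  proof -
    define z where "z = a + of_nat n"
    have z: "z \<noteq> 0" by (simp add: z_def shift_nz)
    have e: "z ^ (2 * k) = z * z ^ (2 * k - 1)"
      using k by (simp flip: power_Suc)
    have frac: "z * (1 + (x / z) ^ (2 * k)) = (z ^ (2 * k) + x ^ (2 * k)) / z ^ (2 * k - 1)"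
    proof -
      have "z * (1 + y / (z * q)) = (z * q + y) / q" if "q \<noteq> 0" for y q
        using z that by (simp add: field_simps)
      from this[of "z ^ (2 * k - 1)" "x ^ (2 * k)", folded e] z show ?thesis
        unfolding power_divide by simp
    qed
    have "e * (2 / (D / q)) / 2 = e * q / D" for e D q :: complex
      by simp
    thus ?thesis
      unfolding J_def F_0(2) z_def[symmetric] frac .
  qed
  ultimately show ?thesis by simp
qed

end

section \<open>Absolutely convergent double series\<close>

lemma norm_shift_ge:
  fixes a :: complex
  assumes "a \<notin> \<int>\<^sub>\<le>\<^sub>0"
  obtains \<kappa> where "\<kappa> > 0" "\<And>n. norm (of_nat n + a) \<ge> \<kappa> * (real n + 1)"
proof -
  define g where "g n = norm (of_nat n + a) / (real n + 1)" for n
  \<comment> \<open>From this index on n - |a| >= (n + 1) / 2, so only finitely many positive ratios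
    have to be included in the minimum.\<close>
  define N where "N = nat \<lceil>2 * norm a + 1\<rceil>"
  define \<kappa> where "\<kappa> = Min (insert (1 / 2) (g ` {..<N}))"
  have "g n > 0" for n
    using nonpos_Ints_shift_nz[OF assms, of n] by (simp add: g_def)
  hence "\<kappa> > 0" by (auto simp: \<kappa>_def)
  moreover have "\<kappa> \<le> g n" for n
  proof (cases "n < N")
    case False
    hence "real n \<ge> 2 * norm a + 1" unfolding N_def by linarith
    moreover have "norm (of_nat n + a) \<ge> real n - norm a"
      using norm_diff_ineq[of "of_nat n" a] by simp
    ultimately have "1 / 2 \<le> g n" by (simp add: g_def field_simps)
    thus ?thesis by (auto simp: \<kappa>_def Min_le_iff)
  qed (auto simp: \<kappa>_def)
  hence "\<kappa> * (real n + 1) \<le> norm (of_nat n + a)" for n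
    by (simp add: g_def field_simps)
  ultimately show ?thesis using that by blast
qed

text \<open>Real parts are bounded rather than norms, because two such powers are added later and
  must not cancel. Since (1 + a/n)^(2k) tends to 1, its real part eventually exceeds 1/2; with (n +
  1)^2 <= 4 n^2 this gives 1/8. The finitely many exceptions, where the real part may be negative,
  go into C.\<close>

lemma Re_power_shift_ge:
  assumes "k \<ge> 1"
  obtains C where "\<And>n. Re ((of_nat n + a) ^ (2 * k)) \<ge> (real n + 1)\<^sup>2 / 8 - C"
proof -
  define h where "h n = Re ((of_nat n + a) ^ (2 * k))" for n
  have "(\<lambda>n. (1 + a * inverse (0 + of_nat n)) ^ (2 * k)) \<longlonglongrightarrow> (1 + a * 0) ^ (2 * k)"
    by (intro tendsto_intros inverse_shift_tendsto_0)
  hence "(\<lambda>n. Re ((1 + a * inverse (0 + of_nat n)) ^ (2 * k))) \<longlonglongrightarrow> 1"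
    using tendsto_Re by fastforce
  hence "\<forall>\<^sub>F n in sequentially. Re ((1 + a * inverse (0 + of_nat n)) ^ (2 * k)) > 1 / 2"
    by (rule order_tendstoD(1)) simp
  hence "\<forall>\<^sub>F n in sequentially. (real n + 1)\<^sup>2 / 8 \<le> h n"
    using eventually_ge_at_top[of 1]
  proof eventually_elim
    case (elim n)
    have "of_nat n + a = of_nat n * (1 + a * inverse (0 + of_nat n))"
      using elim by (simp add: field_simps)
    hence "(of_nat n + a) ^ (2 * k)
        = of_real (real n ^ (2 * k)) * (1 + a * inverse (0 + of_nat n)) ^ (2 * k)"
      by (simp only: power_mult_distrib of_real_power of_real_of_nat_eq)
    hence h: "h n = real n ^ (2 * k) * Re ((1 + a * inverse (0 + of_nat n)) ^ (2 * k))"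
      unfolding h_def by (simp only: Re_complex_of_real Im_complex_of_real times_complex.sel)
    have "(real n + 1)\<^sup>2 \<le> (2 * real n)\<^sup>2"
      using elim by (intro power_mono) auto
    hence "(real n + 1)\<^sup>2 / 8 \<le> real n ^ 2 * (1 / 2)"
      by (simp add: power_mult_distrib)
    also have "\<dots> \<le> h n"
      unfolding h using elim assms by (intro mult_mono power_increasing) auto
    finally show ?case .
  qed
  then obtain N where N: "\<And>n. n \<ge> N \<Longrightarrow> (real n + 1)\<^sup>2 / 8 \<le> h n"
    by (auto simp: eventually_at_top_linorder)
  define C where "C = (\<Sum>n<N. \<bar>(real n + 1)\<^sup>2 / 8 - h n\<bar>)"
  have "(real n + 1)\<^sup>2 / 8 - C \<le> h n" for n
  proof (cases "n < N")
    case True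
    hence "\<bar>(real n + 1)\<^sup>2 / 8 - h n\<bar> \<le> C"
      unfolding C_def by (intro member_le_sum) auto
    thus ?thesis by linarith
  next
    case False
    have "C \<ge> 0" by (auto simp: C_def intro: sum_nonneg)
    with N[of n] False show ?thesis by auto
  qed
  thus ?thesis using that unfolding h_def by blast
qed

text \<open>Real parts give |W| >= p q - C with q a sum of two squares. Outside the finite set S the
  constant costs at most half of p q, and q >= 2 (n + 1)(i + 1). On S the sum is merely nonzero,
  which suffices for a minimum.\<close>

lemma norm_power_sum_ge:
  fixes a b :: complex and u v :: real
  assumes k: "k \<ge> 1" and uv: "u > 0" "v > 0"
    and nz: "\<And>n i. of_real u * (of_nat i + b) ^ (2 * k) + of_real v * (of_nat n + a) ^ (2 * k) \<noteq> 0"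
  obtains \<kappa> where "\<kappa> > 0"
    "\<And>n i. norm (of_real u * (of_nat i + b) ^ (2 * k) + of_real v * (of_nat n + a) ^ (2 * k))
       \<ge> \<kappa> * ((real n + 1) * (real i + 1))"
proof -
  obtain C1 where C1: "\<And>n. Re ((of_nat n + a) ^ (2 * k)) \<ge> (real n + 1)\<^sup>2 / 8 - C1"
    using Re_power_shift_ge[OF k] by blast
  obtain C2 where C2: "\<And>n. Re ((of_nat n + b) ^ (2 * k)) \<ge> (real n + 1)\<^sup>2 / 8 - C2"
    using Re_power_shift_ge[OF k] by blast
  define W where "W = (\<lambda>(n, i). of_real u * (of_nat i + b) ^ (2 * k) + of_real v * (of_nat n + a) ^ (2 * k))"
  define q where "q = (\<lambda>(n, i). (real n + 1)\<^sup>2 + (real i + 1)\<^sup>2)"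
  define g where "g p = norm (W p) / (real (fst p) + 1) / (real (snd p) + 1)" for p
  define p where "p = min u v / 8"
  define C where "C = u * C2 + v * C1"
  define S where "S = {z. p * q z < 2 * C}"
  have p: "p > 0" using uv by (simp add: p_def)
  have lower: "norm (W z) \<ge> p * q z - C" for z
  proof (cases z)
    case (Pair n i)
    have "p * (real n + 1)\<^sup>2 \<le> v * ((real n + 1)\<^sup>2 / 8)" "p * (real i + 1)\<^sup>2 \<le> u * ((real i + 1)\<^sup>2 / 8)"
      unfolding p_def by (auto intro!: mult_right_mono)
    moreover have "v * ((real n + 1)\<^sup>2 / 8) - v * C1 \<le> v * Re ((of_nat n + a) ^ (2 * k))"
      "u * ((real i + 1)\<^sup>2 / 8) - u * C2 \<le> u * Re ((of_nat i + b) ^ (2 * k))"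
      using uv C1 C2 unfolding right_diff_distrib[symmetric] by (intro mult_left_mono; simp)+
    moreover have "Re (W z) = u * Re ((of_nat i + b) ^ (2 * k)) + v * Re ((of_nat n + a) ^ (2 * k))"
      by (simp add: W_def Pair)
    moreover have "p * q z = p * (real n + 1)\<^sup>2 + p * (real i + 1)\<^sup>2"
      by (simp add: q_def Pair distrib_left)
    ultimately have "p * q z - C \<le> Re (W z)"
      unfolding C_def by linarith
    thus ?thesis using complex_Re_le_cmod order.trans by blast
  qed
  have "finite S"
  proof (rule finite_subset)
    define M where "M = nat \<lceil>2 * C / p\<rceil>"
    show "S \<subseteq> {..M} \<times> {..M}"
    proof
      fix z assume "z \<in> S"
      then obtain n i where z: "z = (n, i)" "p * q (n, i) < 2 * C" by (cases z) (auto simp: S_def)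
      hence "q (n, i) < 2 * C / p" using p by (simp add: field_simps)
      moreover have "(real n + 1)\<^sup>2 \<ge> real n" "(real i + 1)\<^sup>2 \<ge> real i"
        by (simp_all add: power2_eq_square algebra_simps)
      moreover have "q (n, i) = (real n + 1)\<^sup>2 + (real i + 1)\<^sup>2" by (simp add: q_def)
      moreover have "(real n + 1)\<^sup>2 \<ge> 0" "(real i + 1)\<^sup>2 \<ge> 0" by simp_all
      ultimately have "real n < 2 * C / p" "real i < 2 * C / p" by linarith+
      thus "z \<in> {..M} \<times> {..M}"
        unfolding z(1) M_def by (simp; linarith)
    qed
  qed auto
  define \<kappa> where "\<kappa> = Min (insert p (g ` S))"
  have "W z \<noteq> 0" for z using nz by (cases z) (auto simp: W_def)
  hence "g z > 0" for z by (simp add: g_def)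
  hence "\<kappa> > 0" using p \<open>finite S\<close> by (auto simp: \<kappa>_def)
  moreover have "\<kappa> \<le> g z" for z
  proof (cases "z \<in> S")
    case True
    thus ?thesis using \<open>finite S\<close> by (auto simp: \<kappa>_def)
  next
    case False
    obtain n i where z: "z = (n, i)" by (cases z)
    have "2 * ((real n + 1) * (real i + 1)) \<le> q z"
      using sum_squares_bound[of "real n + 1" "real i + 1"] by (simp only: q_def z prod.case mult.assoc)
    hence "p * ((real n + 1) * (real i + 1)) \<le> p * (q z / 2)"
      using p by (intro mult_left_mono) auto
    also have "\<dots> \<le> norm (W z)"
      using lower[of z] False by (simp add: S_def)
    finally have "p \<le> g z"
      unfolding g_def z divide_divide_eq_left fst_conv snd_conv by (subst pos_le_divide_eq) auto
    moreover have "\<kappa> \<le> p" using \<open>finite S\<close> by (auto simp: \<kappa>_def)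
    ultimately show ?thesis by linarith
  qed
  hence "\<kappa> \<le> norm (W (n, i)) / ((real n + 1) * (real i + 1))" for n i
    by (metis g_def fst_conv snd_conv divide_divide_eq_left)
  hence "\<kappa> * ((real n + 1) * (real i + 1)) \<le> norm (W (n, i))" for n i
    by (subst pos_le_divide_eq[symmetric]) auto
  ultimately show ?thesis using that unfolding W_def by auto
qed

lemma summable_on_inverse_squares:
  fixes f :: "nat \<times> nat \<Rightarrow> complex"
  assumes "\<And>n i. norm (f (n, i)) \<le> K / ((real n + 1)\<^sup>2 * (real i + 1)\<^sup>2)"
  shows "f summable_on UNIV"
proof -
  define h where "h n = 1 / (real n + 1)\<^sup>2" for n
  have "summable h"
    using summable_Suc_iff[THEN iffD2, OF inverse_power_summable[of 2, where ?'a = real]]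
    by (simp add: h_def[abs_def] inverse_eq_divide add.commute)
  hence h: "h summable_on UNIV"
    by (intro norm_summable_imp_summable_on) (simp add: h_def[abs_def])
  have abs_h: "\<bar>h n\<bar> = h n" for n by (simp add: h_def)
  have "(\<lambda>z. norm (case z of (n, i) \<Rightarrow> h n * h i)) summable_on UNIV \<times> UNIV"
    using h by (subst Infinite_Sum.abs_summable_on_Sigma_iff)
      (auto simp: abs_h abs_mult infsum_cmult_right' intro!: summable_on_cmult_left summable_on_cmult_right)
  hence "(\<lambda>z. norm (K * (case z of (n, i) \<Rightarrow> h n * h i))) summable_on UNIV"
    by (simp add: abs_mult summable_on_cmult_right)
  hence "(\<lambda>z. norm (f z)) summable_on UNIV"
  proof (rule Infinite_Sum.abs_summable_on_comparison_test)
    fix z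
    show "norm (f z) \<le> norm (K * (case z of (n, i) \<Rightarrow> h n * h i))"
      using assms by (cases z) (auto simp: h_def intro!: order.trans[OF assms] divide_right_mono)
  qed
  thus ?thesis by (rule abs_summable_summable)
qed

section \<open>From termwise identities to double series\<close>

lemma has_sum_finite_sum:
  fixes f :: "'i \<Rightarrow> 'a \<Rightarrow> 'b::topological_comm_monoid_add"
  assumes "finite I" "\<And>i. i \<in> I \<Longrightarrow> (f i has_sum s i) A"
  shows "((\<lambda>x. \<Sum>i\<in>I. f i x) has_sum (\<Sum>i\<in>I. s i)) A"
  using assms by (induction I rule: finite_induct) (auto intro: has_sum_add)

lemma double_series_sums:
  fixes f :: "nat \<times> nat \<Rightarrow> complex"
  assumes "f summable_on UNIV"
  shows "(\<lambda>i. f (n, i)) sums (\<Sum>i. f (n, i))" and "(\<lambda>n. \<Sum>i. f (n, i)) sums infsum f UNIV"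
proof -
  have f: "(\<lambda>(n, i). f (n, i)) summable_on UNIV \<times> UNIV" using assms by simp
  have row: "(\<lambda>i. f (n, i)) summable_on UNIV" for n
    using summable_on_SigmaD1[OF f, of n] by simp
  have row_sum: "infsum (\<lambda>i. f (n, i)) UNIV = (\<Sum>i. f (n, i))" for n
    using has_sum_imp_sums[OF has_sum_infsum[OF row]] by (simp add: sums_iff)
  show "(\<lambda>i. f (n, i)) sums (\<Sum>i. f (n, i))"
    using has_sum_imp_sums[OF has_sum_infsum[OF row]] row_sum by metis
  have "((\<lambda>n. infsum (\<lambda>i. f (n, i)) UNIV) has_sum infsum f UNIV) UNIV"
  proof (rule has_sum_SigmaD[where B = "\<lambda>_. UNIV"])
    show "(f has_sum infsum f UNIV) (UNIV \<times> UNIV)"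
      using has_sum_infsum[OF assms] by simp
  qed (use row in auto)
  thus "(\<lambda>n. \<Sum>i. f (n, i)) sums infsum f UNIV"
    unfolding row_sum by (rule has_sum_imp_sums)
qed

text \<open>With u = -1/x and v = 1/y this is the factorisation of u^j - v^j: the factor u - v = -(x
  + y) / (x y) cancels the denominator y + x.\<close>

lemma partial_fractions:
  fixes x y :: "'a::field"
  assumes "x \<noteq> 0" "y \<noteq> 0" "y + x \<noteq> 0"
  shows "(-1) ^ j / ((y + x) * x ^ j) = 1 / ((y + x) * y ^ j) + (\<Sum>p=1..j. (-1) ^ p / (x ^ p * y ^ (Suc j - p)))"
proof (induction j)
  case (Suc j)
  have "(\<Sum>p=1..Suc j. (-1) ^ p / (x ^ p * y ^ (Suc (Suc j) - p)))
      = (\<Sum>p=1..j. (-1) ^ p / (x ^ p * y ^ (Suc j - p))) / y + (-1) ^ Suc j / (x ^ Suc j * y)"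
    by (simp add: sum_divide_distrib Suc_diff_le mult_ac)
  also have "(\<Sum>p=1..j. (-1) ^ p / (x ^ p * y ^ (Suc j - p)))
      = (-1) ^ j / ((y + x) * x ^ j) - 1 / ((y + x) * y ^ j)"
    using Suc.IH by (simp add: algebra_simps)
  finally have "1 / ((y + x) * y ^ Suc j) + (\<Sum>p=1..Suc j. (-1) ^ p / (x ^ p * y ^ (Suc (Suc j) - p)))
      = (-1) ^ j / ((y + x) * x ^ j) / y + (-1) ^ Suc j / (x ^ Suc j * y)"
    using assms by (simp add: diff_divide_distrib mult_ac)
  also have "\<dots> = (-1) ^ Suc j / ((y + x) * x ^ Suc j)"
    using assms by (simp add: divide_simps) (simp add: algebra_simps)
  finally show ?case by simp
qed auto

text \<open>The assumptions are invariant under exchanging alpha with beta and a with b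
  simultaneously, so each result below has a mirror image through the interpretation
  \<open>swap\<close>. For complex a and b the sums in \<open>nz\<close> could vanish; their being
  nonzero makes all terms meaningful.\<close>

locale zeta_pair =
  fixes \<alpha> \<beta> :: real and a b :: complex and k :: nat
  assumes \<alpha>: "\<alpha> > 0" and \<beta>: "\<beta> > 0" and k: "k \<ge> 1"
    and a: "a \<notin> \<int>\<^sub>\<le>\<^sub>0" and b: "b \<notin> \<int>\<^sub>\<le>\<^sub>0"
    and nz: "\<And>n i :: nat. of_real \<alpha> ^ k * (of_nat i + b) ^ (2 * k)
                     + of_real \<beta> ^ k * (of_nat n + a) ^ (2 * k) \<noteq> 0"
begin

abbreviation A :: "nat \<Rightarrow> complex" where "A n \<equiv> of_nat n + a"
abbreviation B :: "nat \<Rightarrow> complex" where "B i \<equiv> of_nat i + b"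
definition X :: "nat \<Rightarrow> complex" where "X n = of_real \<beta> ^ k * A n ^ (2 * k)"
definition Y :: "nat \<Rightarrow> complex" where "Y i = of_real \<alpha> ^ k * B i ^ (2 * k)"

lemma A_nz: "A n \<noteq> 0" and B_nz: "B i \<noteq> 0"
  by (rule nonpos_Ints_shift_nz[OF a], rule nonpos_Ints_shift_nz[OF b])

lemma X_nz: "X n \<noteq> 0" and Y_nz: "Y i \<noteq> 0" and YX_nz: "Y i + X n \<noteq> 0"
  using A_nz[of n] B_nz[of i] \<alpha> \<beta> nz by (auto simp: X_def Y_def)

lemma X_power: "X n ^ j = of_real \<beta> ^ (k * j) * A n ^ (2 * k * j)"
  and Y_power: "Y i ^ j = of_real \<alpha> ^ (k * j) * B i ^ (2 * k * j)"
  by (simp_all add: X_def Y_def power_mult_distrib flip: power_mult)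

lemma norm_bounds:
  obtains \<kappa> where "\<kappa> > 0" "\<And>n. norm (A n) \<ge> \<kappa> * (real n + 1)" "\<And>i. norm (B i) \<ge> \<kappa> * (real i + 1)"
    "\<And>n i. norm (Y i + X n) \<ge> \<kappa> * ((real n + 1) * (real i + 1))"
    "\<And>n. norm (X n) \<ge> \<kappa> * (real n + 1)" "\<And>i. norm (Y i) \<ge> \<kappa> * (real i + 1)"
proof -
  obtain \<kappa>1 where 1: "\<kappa>1 > 0" "\<And>n. norm (A n) \<ge> \<kappa>1 * (real n + 1)"
    using norm_shift_ge[OF a] by blast
  obtain \<kappa>2 where 2: "\<kappa>2 > 0" "\<And>n. norm (B n) \<ge> \<kappa>2 * (real n + 1)"
    using norm_shift_ge[OF b] by blast
  obtain \<kappa>3 where 3: "\<kappa>3 > 0" "\<And>n i. norm (Y i + X n) \<ge> \<kappa>3 * ((real n + 1) * (real i + 1))"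
    using norm_power_sum_ge[of k "\<alpha> ^ k" "\<beta> ^ k" b a] \<alpha> \<beta> k nz unfolding X_def Y_def by (auto simp: of_real_power)
  have pow: "\<bar>r ^ k\<bar> * norm z ^ (2 * k) \<ge> r ^ k * \<kappa> ^ (2 * k) * (real n + 1)"
    if "r > 0" "\<kappa> > 0" "norm z \<ge> \<kappa> * (real n + 1)" for r \<kappa> n and z :: complex
  proof -
    have "real n + 1 \<le> (real n + 1) ^ (2 * k)"
      using k by (intro self_le_power) auto
    hence "\<kappa> ^ (2 * k) * (real n + 1) \<le> (\<kappa> * (real n + 1)) ^ (2 * k)"
      using that by (simp add: power_mult_distrib)
    also have "\<dots> \<le> norm z ^ (2 * k)"
      using that by (intro power_mono) auto
    finally show ?thesis using that by (simp add: mult_left_mono)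
  qed
  have 4: "norm (X n) \<ge> \<beta> ^ k * \<kappa>1 ^ (2 * k) * (real n + 1)" for n
    using pow[OF \<beta> 1, of n] \<beta> by (simp add: X_def norm_mult norm_power)
  have 5: "norm (Y n) \<ge> \<alpha> ^ k * \<kappa>2 ^ (2 * k) * (real n + 1)" for n
    using pow[OF \<alpha> 2, of n] \<alpha> by (simp add: Y_def norm_mult norm_power)
  define \<kappa> where "\<kappa> = Min {\<kappa>1, \<kappa>2, \<kappa>3, \<beta> ^ k * \<kappa>1 ^ (2 * k), \<alpha> ^ k * \<kappa>2 ^ (2 * k)}"
  have le: "\<kappa> \<le> \<kappa>1" "\<kappa> \<le> \<kappa>2" "\<kappa> \<le> \<kappa>3" "\<kappa> \<le> \<beta> ^ k * \<kappa>1 ^ (2 * k)" "\<kappa> \<le> \<alpha> ^ k * \<kappa>2 ^ (2 * k)"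
    by (auto simp: \<kappa>_def)
  show ?thesis
  proof (rule that[of \<kappa>])
    show "\<kappa> > 0" using 1 2 3 \<alpha> \<beta> by (auto simp: \<kappa>_def)
  qed (rule order.trans[OF mult_right_mono[OF le(1)] 1(2)] order.trans[OF mult_right_mono[OF le(2)] 2(2)]
      order.trans[OF mult_right_mono[OF le(3)] 3(2)] order.trans[OF mult_right_mono[OF le(4)] 4]
      order.trans[OF mult_right_mono[OF le(5)] 5]; simp)+
qed

text \<open>Up to powers of alpha and beta, \<open>T j 0\<close> and \<open>T 0 j\<close> are the
  general terms of the two double series, and \<open>U\<close> below is that of a product of two
  zeta series.\<close>

definition T :: "nat \<Rightarrow> nat \<Rightarrow> nat \<times> nat \<Rightarrow> complex" where
  "T p q = (\<lambda>(n, i). (-1) ^ n * (-1) ^ i / (A n * B i * (Y i + X n) * X n ^ p * Y i ^ q))"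

definition U :: "nat \<Rightarrow> nat \<Rightarrow> nat \<times> nat \<Rightarrow> complex" where
  "U p q = (\<lambda>(n, i). (-1) ^ n * (-1) ^ i / (A n * B i * X n ^ p * Y i ^ q))"

text \<open>A and B give one factor (n + 1)(i + 1), and Y + X gives the second one; the powers of X
  and Y only need to stay away from 0.\<close>

lemma summable_T: "T p q summable_on UNIV"
proof -
  obtain \<kappa> where \<kappa>: "\<kappa> > 0" and *: "\<And>n. norm (A n) \<ge> \<kappa> * (real n + 1)" "\<And>i. norm (B i) \<ge> \<kappa> * (real i + 1)"
    "\<And>n i. norm (Y i + X n) \<ge> \<kappa> * ((real n + 1) * (real i + 1))"
    "\<And>n. norm (X n) \<ge> \<kappa> * (real n + 1)" "\<And>i. norm (Y i) \<ge> \<kappa> * (real i + 1)"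
    using norm_bounds by blast
  have "\<kappa> \<le> \<kappa> * (real n + 1)" for n
    using \<kappa> by simp
  hence one: "norm (X n) \<ge> \<kappa>" "norm (Y n) \<ge> \<kappa>" for n
    using *(4,5)[of n] order.trans by blast+
  show ?thesis
  proof (rule summable_on_inverse_squares)
    fix n i
    have "\<kappa> * (real n + 1) * (\<kappa> * (real i + 1)) * (\<kappa> * ((real n + 1) * (real i + 1))) * \<kappa> ^ p * \<kappa> ^ q
        \<le> norm (A n) * norm (B i) * norm (Y i + X n) * norm (X n) ^ p * norm (Y i) ^ q"
      using * one \<kappa> by (intro mult_mono power_mono) auto
    hence "1 / (norm (A n) * norm (B i) * norm (Y i + X n) * norm (X n) ^ p * norm (Y i) ^ q)
        \<le> 1 / (\<kappa> * (real n + 1) * (\<kappa> * (real i + 1)) * (\<kappa> * ((real n + 1) * (real i + 1))) * \<kappa> ^ p * \<kappa> ^ q)"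
      using \<kappa> by (intro divide_left_mono mult_pos_pos) (auto simp: A_nz B_nz X_nz Y_nz YX_nz)
    also have "\<dots> = 1 / (\<kappa> ^ 3 * \<kappa> ^ p * \<kappa> ^ q) / ((real n + 1)\<^sup>2 * (real i + 1)\<^sup>2)"
      by (simp add: power2_eq_square power3_eq_cube mult_ac)
    finally show "norm (T p q (n, i)) \<le> 1 / (\<kappa> ^ 3 * \<kappa> ^ p * \<kappa> ^ q) / ((real n + 1)\<^sup>2 * (real i + 1)\<^sup>2)"
      by (simp add: T_def norm_divide norm_mult norm_power)
  qed
qed

text \<open>Without Y + X, the second factor n + 1 must come from X^p and the second factor i + 1
  from Y^q, hence both exponents are at least 1. For p = 0 the sum over n would converge only
  conditionally.\<close>

lemma summable_U:
  assumes "p \<ge> 1" "q \<ge> 1"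
  shows "U p q summable_on UNIV"
proof -
  obtain \<kappa> where \<kappa>: "\<kappa> > 0" and *: "\<And>n. norm (A n) \<ge> \<kappa> * (real n + 1)" "\<And>i. norm (B i) \<ge> \<kappa> * (real i + 1)"
    "\<And>n i. norm (Y i + X n) \<ge> \<kappa> * ((real n + 1) * (real i + 1))"
    "\<And>n. norm (X n) \<ge> \<kappa> * (real n + 1)" "\<And>i. norm (Y i) \<ge> \<kappa> * (real i + 1)"
    using norm_bounds by blast
  have "\<kappa> \<le> \<kappa> * (real n + 1)" for n
    using \<kappa> by simp
  hence one: "norm (X n) \<ge> \<kappa>" "norm (Y n) \<ge> \<kappa>" for n
    using *(4,5)[of n] order.trans by blast+
  obtain p' q' where pq: "p = Suc p'" "q = Suc q'" using assms by (cases p; cases q) auto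
  show ?thesis
  proof (rule summable_on_inverse_squares)
    fix n i
    have "\<kappa> * (real n + 1) * (\<kappa> * (real i + 1)) * (\<kappa> * (real n + 1) * \<kappa> ^ p') * (\<kappa> * (real i + 1) * \<kappa> ^ q')
        \<le> norm (A n) * norm (B i) * (norm (X n) * norm (X n) ^ p') * (norm (Y i) * norm (Y i) ^ q')"
      using * one \<kappa> by (intro mult_mono power_mono) auto
    hence "1 / (norm (A n) * norm (B i) * (norm (X n) * norm (X n) ^ p') * (norm (Y i) * norm (Y i) ^ q'))
        \<le> 1 / (\<kappa> * (real n + 1) * (\<kappa> * (real i + 1)) * (\<kappa> * (real n + 1) * \<kappa> ^ p') * (\<kappa> * (real i + 1) * \<kappa> ^ q'))"
      using \<kappa> by (intro divide_left_mono mult_pos_pos) (auto simp: A_nz B_nz X_nz Y_nz YX_nz)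
    also have "\<dots> = 1 / (\<kappa> ^ 4 * \<kappa> ^ p' * \<kappa> ^ q') / ((real n + 1)\<^sup>2 * (real i + 1)\<^sup>2)"
      by (simp add: power2_eq_square power4_eq_xxxx mult_ac)
    finally show "norm (U p q (n, i)) \<le> 1 / (\<kappa> ^ 4 * \<kappa> ^ p' * \<kappa> ^ q') / ((real n + 1)\<^sup>2 * (real i + 1)\<^sup>2)"
      by (simp add: U_def norm_divide norm_mult norm_power pq)
  qed
qed

lemma row_sums: "(\<lambda>i. (-1) ^ i / (B i * (Y i + X n))) sums (\<Sum>i. (-1) ^ i / (B i * (Y i + X n)))"
proof -
  have "(\<lambda>i. T 0 0 (n, i) * ((-1) ^ n * A n)) sums ((\<Sum>i. T 0 0 (n, i)) * ((-1) ^ n * A n))"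
    by (rule sums_mult2[OF double_series_sums(1)[OF summable_T]])
  moreover have "T 0 0 (n, i) * ((-1) ^ n * A n) = (-1) ^ i / (B i * (Y i + X n))" for i
    using A_nz[of n] by (simp add: T_def mult_ac)
  ultimately show ?thesis by (simp add: sums_iff)
qed

text \<open>Of the j + 1 factors beta^k, j cancel those inside X^j and the last one is the beta^k in
  the numerator of the theorem.\<close>

lemma iterated_sums:
  "(\<lambda>n. (-1) ^ n * of_real \<beta> ^ k / A n ^ (2 * k * j + 1) * (\<Sum>i. (-1) ^ i / (B i * (Y i + X n))))
    sums (of_real \<beta> ^ (k * Suc j) * infsum (T j 0) UNIV)"
proof -
  have "(\<lambda>n. of_real \<beta> ^ (k * Suc j) * (\<Sum>i. T j 0 (n, i))) sums (of_real \<beta> ^ (k * Suc j) * infsum (T j 0) UNIV)"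
    by (rule sums_mult[OF double_series_sums(2)[OF summable_T]])
  moreover have "of_real \<beta> ^ (k * Suc j) * (\<Sum>i. T j 0 (n, i))
      = (-1) ^ n * of_real \<beta> ^ k / A n ^ (2 * k * j + 1) * (\<Sum>i. (-1) ^ i / (B i * (Y i + X n)))" for n
  proof -
    define R where "R = (-1) ^ n / (A n * X n ^ j)"
    have "T j 0 (n, i) = R * ((-1) ^ i / (B i * (Y i + X n)))" for i
      by (simp add: T_def R_def mult_ac)
    hence "(\<Sum>i. T j 0 (n, i)) = R * (\<Sum>i. (-1) ^ i / (B i * (Y i + X n)))"
      using suminf_mult[OF sums_summable[OF row_sums]] by simp
    moreover have "of_real \<beta> ^ (k * Suc j) * R = (-1) ^ n * of_real \<beta> ^ k / A n ^ (2 * k * j + 1)"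
      using \<beta> by (simp add: R_def X_power power_add mult_ac)
    ultimately show ?thesis by (simp flip: mult.assoc)
  qed
  ultimately show ?thesis by simp
qed

lemma infsum_U:
  assumes "p \<ge> 1" "q \<ge> 1"
  shows "of_real \<beta> ^ (k * p) * of_real \<alpha> ^ (k * q) * infsum (U p q) UNIV
    = zeta_E (of_nat (2 * k * p + 1)) a * zeta_E (of_nat (2 * k * q + 1)) b"
proof -
  define u where "u n = (-1) ^ n / A n ^ (2 * k * p + 1)" for n
  define v where "v i = (-1) ^ i / B i ^ (2 * k * q + 1)" for i
  have u: "u sums zeta_E (of_nat (2 * k * p + 1)) a" and v: "v sums zeta_E (of_nat (2 * k * q + 1)) b"
    unfolding u_def v_def by (rule zeta_E_sums_power[OF a le_add2], rule zeta_E_sums_power[OF b le_add2])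
  have UE: "of_real \<beta> ^ (k * p) * of_real \<alpha> ^ (k * q) * U p q (n, i) = u n * v i" for n i
    using \<alpha> \<beta> by (simp add: U_def u_def v_def X_power Y_power mult_ac)
  have "(\<lambda>n. of_real \<beta> ^ (k * p) * of_real \<alpha> ^ (k * q) * (\<Sum>i. U p q (n, i)))
      sums (of_real \<beta> ^ (k * p) * of_real \<alpha> ^ (k * q) * infsum (U p q) UNIV)"
    by (rule sums_mult[OF double_series_sums(2)[OF summable_U[OF assms]]])
  moreover have "of_real \<beta> ^ (k * p) * of_real \<alpha> ^ (k * q) * (\<Sum>i. U p q (n, i))
      = u n * zeta_E (of_nat (2 * k * q + 1)) b" for n
  proof -
    have "of_real \<beta> ^ (k * p) * of_real \<alpha> ^ (k * q) * (\<Sum>i. U p q (n, i)) = (\<Sum>i. u n * v i)"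
      by (subst suminf_mult[symmetric, OF sums_summable[OF double_series_sums(1)[OF summable_U[OF assms]]]])
        (simp only: UE)
    also have "\<dots> = u n * zeta_E (of_nat (2 * k * q + 1)) b"
      using sums_mult[OF v] by (simp add: sums_iff)
    finally show ?thesis .
  qed
  ultimately have "(\<lambda>n. u n * zeta_E (of_nat (2 * k * q + 1)) b)
      sums (of_real \<beta> ^ (k * p) * of_real \<alpha> ^ (k * q) * infsum (U p q) UNIV)"
    by simp
  with sums_mult2[OF u] show ?thesis by (metis sums_unique2)
qed

lemma infsum_T:
  "(-1) ^ j * infsum (T j 0) UNIV = infsum (T 0 j) UNIV + (\<Sum>p=1..j. (-1) ^ p * infsum (U p (Suc j - p)) UNIV)"
proof -
  have pt: "(-1) ^ j * T j 0 z = T 0 j z + (\<Sum>p=1..j. (-1) ^ p * U p (Suc j - p) z)" for z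
  proof (cases z)
    case (Pair n i)
    define R where "R = (-1) ^ n * (-1) ^ i / (A n * B i)"
    have "(-1) ^ j * T j 0 z = R * ((-1) ^ j / ((Y i + X n) * X n ^ j))"
      by (simp add: T_def R_def Pair mult_ac)
    also have "\<dots> = R * (1 / ((Y i + X n) * Y i ^ j)) + R * (\<Sum>p=1..j. (-1) ^ p / (X n ^ p * Y i ^ (Suc j - p)))"
      by (subst partial_fractions[OF X_nz Y_nz YX_nz]) (rule ring_distribs)
    also have "R * (1 / ((Y i + X n) * Y i ^ j)) = T 0 j z"
      by (simp add: T_def R_def Pair mult_ac)
    also have "R * (\<Sum>p=1..j. (-1) ^ p / (X n ^ p * Y i ^ (Suc j - p))) = (\<Sum>p=1..j. (-1) ^ p * U p (Suc j - p) z)"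
      unfolding sum_distrib_left by (intro sum.cong refl) (simp add: U_def R_def Pair mult_ac)
    finally show ?thesis .
  qed
  have "((\<lambda>z. T 0 j z + (\<Sum>p=1..j. (-1) ^ p * U p (Suc j - p) z)) has_sum
      (infsum (T 0 j) UNIV + (\<Sum>p=1..j. (-1) ^ p * infsum (U p (Suc j - p)) UNIV))) UNIV"
    by (intro has_sum_add has_sum_finite_sum has_sum_cmult_right has_sum_infsum summable_T summable_U) auto
  moreover have "((\<lambda>z. (-1) ^ j * T j 0 z) has_sum ((-1) ^ j * infsum (T j 0) UNIV)) UNIV"
    by (intro has_sum_cmult_right has_sum_infsum summable_T)
  ultimately show ?thesis
    unfolding pt by (rule has_sum_unique[rotated])
qed

end

lemma zeta_pair_swap:
  assumes "zeta_pair \<alpha> \<beta> a b k"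
  shows "zeta_pair \<beta> \<alpha> b a k"
  using assms by (auto simp: zeta_pair_def add.commute)

context zeta_pair
begin

interpretation swap: zeta_pair \<beta> \<alpha> b a k
  by (rule zeta_pair_swap) unfold_locales

text \<open>Here the order of summation is interchanged: the unordered sum over pairs is invariant
  under swapping the components.\<close>

lemma infsum_T_swap: "infsum (swap.T p 0) UNIV = infsum (T 0 p) UNIV"
proof -
  have "infsum (T 0 p) (prod.swap ` UNIV) = infsum (T 0 p \<circ> prod.swap) UNIV"
    by (rule infsum_reindex) (auto intro: injI)
  also have "T 0 p \<circ> prod.swap = swap.T p 0"
    by (auto simp: fun_eq_iff T_def swap.T_def X_def swap.X_def Y_def swap.Y_def mult_ac add.commute)
  finally show ?thesis by (simp add: surj_swap)
qed

lemma double_series_identity: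
  assumes "m \<ge> 1"
  shows "(-1) ^ (m + 1) * of_real \<alpha> ^ (k * m) *
          (\<Sum>n. (-1) ^ n * of_real \<beta> ^ k / (of_nat n + a) ^ (2 * k * (m - 1) + 1) *
             (\<Sum>i. (-1) ^ i / ((of_nat i + b) *
                 (of_real \<alpha> ^ k * (of_nat i + b) ^ (2 * k)
                  + of_real \<beta> ^ k * (of_nat n + a) ^ (2 * k)))))
      = of_real \<beta> ^ (k * m) *
          (\<Sum>n. (-1) ^ n * of_real \<alpha> ^ k / (of_nat n + b) ^ (2 * k * (m - 1) + 1) *
             (\<Sum>i. (-1) ^ i / ((of_nat i + a) *
                 (of_real \<beta> ^ k * (of_nat i + a) ^ (2 * k)
                  + of_real \<alpha> ^ k * (of_nat n + b) ^ (2 * k)))))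
        + (\<Sum>p = 1..m - 1. (-1) ^ p * zeta_E (of_nat (2 * k * p + 1)) a
                         * zeta_E (of_nat (2 * k * (m - p) + 1)) b
                         * of_real \<alpha> ^ (k * p) * of_real \<beta> ^ (k * (m - p)))"
    (is "_ * _ * ?S1 = _ * ?S2 + ?Z")
proof -
  obtain j where m: "m = Suc j" using assms by (cases m) auto
  have S1: "?S1 = of_real \<beta> ^ (k * m) * infsum (T j 0) UNIV"
    using iterated_sums[of j] by (simp add: m sums_iff X_def Y_def)
  have S2: "?S2 = of_real \<alpha> ^ (k * m) * infsum (T 0 j) UNIV"
    using swap.iterated_sums[of j] by (simp add: m sums_iff swap.X_def swap.Y_def infsum_T_swap)
  have Z: "?Z = (\<Sum>p = 1..j. of_real \<alpha> ^ (k * m) * of_real \<beta> ^ (k * m) * ((-1) ^ p * infsum (U p (m - p)) UNIV))"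
  proof (rule sum.cong)
    fix p assume p: "p \<in> {1..j}"
    hence "m = p + (m - p)" by (simp add: m)
    hence "k * m = k * p + k * (m - p)" by (metis distrib_left)
    hence split: "r ^ (k * m) = r ^ (k * p) * r ^ (k * (m - p))" for r :: complex
      by (simp add: power_add)
    have "p \<ge> 1" "m - p \<ge> 1" using p by (auto simp: m)
    from infsum_U[OF this, symmetric]
    show "(-1) ^ p * zeta_E (of_nat (2 * k * p + 1)) a * zeta_E (of_nat (2 * k * (m - p) + 1)) b
           * of_real \<alpha> ^ (k * p) * of_real \<beta> ^ (k * (m - p))
        = of_real \<alpha> ^ (k * m) * of_real \<beta> ^ (k * m) * ((-1) ^ p * infsum (U p (m - p)) UNIV)"
      unfolding split by (simp add: mult_ac)
  qed (simp add: m)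
  define D where "D = (of_real \<alpha> ^ (k * m) * of_real \<beta> ^ (k * m) :: complex)"
  have "(-1) ^ (m + 1) * of_real \<alpha> ^ (k * m) * ?S1 = D * ((-1) ^ j * infsum (T j 0) UNIV)"
    unfolding S1 by (simp add: m D_def mult_ac)
  also have "\<dots> = D * infsum (T 0 j) UNIV + D * (\<Sum>p = 1..j. (-1) ^ p * infsum (U p (m - p)) UNIV)"
    unfolding infsum_T m by (rule distrib_left)
  also have "D * infsum (T 0 j) UNIV = of_real \<beta> ^ (k * m) * ?S2"
    unfolding S2 D_def by (simp add: mult_ac)
  also have "D * (\<Sum>p = 1..j. (-1) ^ p * infsum (U p (m - p)) UNIV) = ?Z"
    unfolding Z D_def by (rule sum_distrib_left)
  finally show ?thesis .
qed

end

section \<open>The two identities\<close>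

text \<open>Moving to the right along a horizontal ray turns the argument monotonically towards 0.
  So conditions on \<open>Arg a\<close> and \<open>Arg b\<close> alone control the angles of all
  shifts.\<close>

lemma Arg_shift_bounds:
  assumes "Re a > 0" "r \<ge> 0"
  shows "min 0 (Arg a) \<le> Arg (a + of_real r)" "Arg (a + of_real r) \<le> max 0 (Arg a)"
proof -
  have eq: "Arg a = arctan (Im a / Re a)" "Arg (a + of_real r) = arctan (Im a / (Re a + r))"
    using assms by (auto simp: arg_conv_arctan)
  have "min 0 (Arg a) \<le> Arg (a + of_real r) \<and> Arg (a + of_real r) \<le> max 0 (Arg a)"
  proof (cases "Im a \<ge> 0")
    case True
    hence "Im a / (Re a + r) \<le> Im a / Re a" "0 \<le> Im a / (Re a + r)"
      using assms by (auto intro!: divide_left_mono)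
    thus ?thesis unfolding eq by (auto simp: min_le_iff_disj le_max_iff_disj intro: arctan_monotone')
  next
    case False
    hence "Im a / Re a \<le> Im a / (Re a + r)" "Im a / (Re a + r) \<le> 0"
      using assms by (auto intro!: divide_left_mono_neg divide_nonpos_nonneg)
    thus ?thesis unfolding eq by (auto simp: min_le_iff_disj le_max_iff_disj intro: arctan_monotone')
  qed
  thus "min 0 (Arg a) \<le> Arg (a + of_real r)" "Arg (a + of_real r) \<le> max 0 (Arg a)"
    by auto
qed

lemma Re_pos_of_Arg:
  assumes "z \<noteq> 0" "\<bar>Arg z\<bar> < pi / (2 * real k)" "k \<ge> 1"
  shows "Re z > 0"
proof -
  have "pi / (2 * real k) \<le> pi / 2"
    using assms by (intro divide_left_mono) auto
  thus ?thesis
    using assms Re_Ln_pos_lt[of z] by (simp add: Arg_eq_Im_Ln)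
qed

context zeta_pair
begin

interpretation swap: zeta_pair \<beta> \<alpha> b a k
  by (rule zeta_pair_swap) unfold_locales

text \<open>The termwise splitting X / (A (X + Y)) = 1/A - Y / (A (X + Y)) separates
  \<open>zeta_E 1 a\<close>, the negative of the alternating digamma function at a. What is left is
  an inner series of the second identity.\<close>

lemma scaled_kernel_G_eq:
  assumes prod: "\<alpha> * \<beta> = pi\<^sup>2" and c: "1 < c" "c < 2"
    and Arg: "\<bar>Arg a\<bar> < pi / (2 * real k)" "\<bar>Arg b\<bar> < pi / (2 * real k)"
      "\<bar>Arg a - Arg b\<bar> < pi / (2 * real k)"
  shows "of_real pi * scaled_kernel_G \<alpha> c (B n) a k
    = zeta_E 1 a - Y n * (\<Sum>i. (-1) ^ i / (A i * (X i + Y n)))"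
proof -
  have Re: "Re a > 0" "Re b > 0"
    using A_nz[of 0] B_nz[of 0] Arg k Re_pos_of_Arg by auto
  note not_pole = a
  define x where "x = of_real \<alpha> * B n / of_real pi"
  \<comment> \<open>The two arguments range over the intervals between 0 and \<open>Arg b\<close>
    and between 0 and \<open>Arg a\<close>; these three numbers bound every difference of such
    values.\<close>
  define \<theta> where "\<theta> = max (max \<bar>Arg a\<bar> \<bar>Arg b\<bar>) \<bar>Arg a - Arg b\<bar>"
  have x: "x \<noteq> 0" using \<alpha> B_nz by (simp add: x_def)
  have Arg_x: "Arg x = Arg (B n)" using \<alpha> by (simp add: x_def)
  interpret kernel_params c x a k \<theta>
  proof
    show "\<theta> < pi / (2 * real k)" using Arg by (simp add: \<theta>_def)
    fix r :: real assume r: "r \<ge> 0"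
    have "Re (a + of_real r) > 0" using Re r by simp
    hence "a + of_real r \<noteq> 0" by (metis less_irrefl zero_complex.sel(1))
    hence "\<bar>Im (Ln x) - Im (Ln (a + of_real r))\<bar> = \<bar>Arg (b + of_real (real n)) - Arg (a + of_real r)\<bar>"
      using x Arg_x by (simp add: add.commute flip: Arg_eq_Im_Ln)
    also have "\<dots> \<le> \<theta>"
      using Arg_shift_bounds[OF Re(2), of "real n"] Arg_shift_bounds[OF Re(1) r] unfolding \<theta>_def by linarith
    finally show "\<bar>Im (Ln x) - Im (Ln (a + of_real r))\<bar> \<le> \<theta>" .
  qed (use c k x Re in auto)
  \<comment> \<open>The relation alpha beta = pi^2 acts here through beta (alpha / pi)^2 = alpha,
    turning the scaled argument of the kernel into Y n.\<close>
  have Yx: "of_real \<beta> ^ k * x ^ (2 * k) = Y n"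
  proof -
    have "\<beta> ^ k * (\<alpha> / pi) ^ (2 * k) = (\<beta> * (\<alpha> / pi)\<^sup>2) ^ k"
      by (simp add: power_mult power_mult_distrib)
    also have "\<beta> * (\<alpha> / pi)\<^sup>2 = \<alpha> * (\<alpha> * \<beta>) / pi\<^sup>2"
      by (simp add: power2_eq_square)
    finally have "\<beta> ^ k * (\<alpha> / pi) ^ (2 * k) = \<alpha> ^ k"
      unfolding prod by simp
    hence "of_real (\<beta> ^ k * (\<alpha> / pi) ^ (2 * k)) = (of_real (\<alpha> ^ k) :: complex)"
      by (rule arg_cong)
    hence "of_real \<beta> ^ k * (of_real \<alpha> / of_real pi) ^ (2 * k) = (of_real \<alpha> ^ k :: complex)"
      by simp
    moreover have "x = (of_real \<alpha> / of_real pi) * B n" by (simp add: x_def)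
    ultimately show ?thesis
      by (simp only: Y_def power_mult_distrib mult.assoc[symmetric])
  qed
  have "(\<lambda>i. (-1) ^ i / (A i) ^ 1 - Y n * ((-1) ^ i / (A i * (X i + Y n))))
      sums (zeta_E (of_nat 1) a - Y n * (\<Sum>i. (-1) ^ i / (A i * (X i + Y n))))"
    using swap.row_sums[of n]
    by (intro sums_diff sums_mult zeta_E_sums_power not_pole)
       (simp_all add: X_def Y_def swap.X_def swap.Y_def)
  moreover have "(-1) ^ i / (A i) ^ 1 - Y n * ((-1) ^ i / (A i * (X i + Y n)))
      = (-1) ^ i * (a + of_nat i) ^ (2 * k - 1) / ((a + of_nat i) ^ (2 * k) + x ^ (2 * k))" for i
  proof -
    define z where "z = A i"
    have z: "z \<noteq> 0" by (simp add: z_def A_nz)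
    have e: "z ^ (2 * k) = z * z ^ (2 * k - 1)"
      using k by (simp flip: power_Suc)
    have XY: "X i + Y n \<noteq> 0" using YX_nz[of n i] by (simp add: add.commute)
    have "of_real \<beta> ^ k * (z ^ (2 * k) + x ^ (2 * k)) = X i + Y n"
      by (simp add: X_def z_def distrib_left Yx)
    hence "z ^ (2 * k - 1) / (z ^ (2 * k) + x ^ (2 * k)) = of_real \<beta> ^ k * z ^ (2 * k - 1) / (X i + Y n)"
      using \<beta> by (metis mult_divide_mult_cancel_left power_not_zero of_real_eq_0_iff less_irrefl)
    also have "\<dots> = X i / (z * (X i + Y n))"
      using z by (simp add: X_def e flip: z_def)
    also have "\<dots> = 1 / z - Y n / (z * (X i + Y n))"
      using XY by (simp add: eq_diff_eq flip: add_divide_distrib)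
    finally show ?thesis
      by (simp add: z_def add.commute right_diff_distrib flip: times_divide_eq_right)
         (simp add: right_diff_distrib)
  qed
  ultimately have "(\<lambda>i. (-1) ^ i * (a + of_nat i) ^ (2 * k - 1) / ((a + of_nat i) ^ (2 * k) + x ^ (2 * k)))
      sums (zeta_E 1 a - Y n * (\<Sum>i. (-1) ^ i / (A i * (X i + Y n))))"
    by simp
  with kernel_sums have "of_real pi * kernel_G c x a k = zeta_E 1 a - Y n * (\<Sum>i. (-1) ^ i / (A i * (X i + Y n)))"
    by (rule sums_unique2)
  thus ?thesis by (simp add: scaled_kernel_G_def x_def)
qed

lemma kernel_series:
  assumes prod: "\<alpha> * \<beta> = pi\<^sup>2" and c: "1 < c" "c < 2"
    and Arg: "\<bar>Arg a\<bar> < pi / (2 * real k)" "\<bar>Arg b\<bar> < pi / (2 * real k)"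
      "\<bar>Arg a - Arg b\<bar> < pi / (2 * real k)"
    and m: "m \<ge> 1"
  shows "of_real pi * (\<Sum>n. (-1) ^ n * scaled_kernel_G \<alpha> c (of_nat n + b) a k / (of_nat n + b) ^ (2 * k * m + 1))
    = zeta_E 1 a * zeta_E (of_nat (2 * k * m + 1)) b
      - (\<Sum>n. (-1) ^ n * of_real \<alpha> ^ k / (of_nat n + b) ^ (2 * k * (m - 1) + 1) *
             (\<Sum>i. (-1) ^ i / ((of_nat i + a) *
                 (of_real \<beta> ^ k * (of_nat i + a) ^ (2 * k)
                  + of_real \<alpha> ^ k * (of_nat n + b) ^ (2 * k)))))"
    (is "_ * suminf ?g = _ - suminf ?f")
proof -
  have "?f sums suminf ?f"
    using swap.iterated_sums[of "m - 1"] by (simp add: sums_iff swap.X_def swap.Y_def)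
  moreover have "(\<lambda>n. zeta_E 1 a * ((-1) ^ n / B n ^ (2 * k * m + 1)))
      sums (zeta_E 1 a * zeta_E (of_nat (2 * k * m + 1)) b)"
    by (intro sums_mult zeta_E_sums_power b) simp
  ultimately have "(\<lambda>n. zeta_E 1 a * ((-1) ^ n / B n ^ (2 * k * m + 1)) - ?f n)
      sums (zeta_E 1 a * zeta_E (of_nat (2 * k * m + 1)) b - suminf ?f)"
    by (rule sums_diff[rotated])
  moreover have "zeta_E 1 a * ((-1) ^ n / B n ^ (2 * k * m + 1)) - ?f n = of_real pi * ?g n" for n
  proof -
    define Z where "Z = (\<Sum>i. (-1) ^ i / (A i * (X i + Y n)))"
    have f: "?f n = (-1) ^ n * of_real \<alpha> ^ k / B n ^ (2 * k * (m - 1) + 1) * Z"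
      by (simp add: Z_def X_def Y_def)
    \<comment> \<open>The factor B^(2k) inside Y cancels part of the denominator, which lowers m to
      m - 1 as in the second identity.\<close>
    have "2 * k * m + 1 = 2 * k + (2 * k * (m - 1) + 1)"
      using m by (cases m) auto
    hence "B n ^ (2 * k * m + 1) = B n ^ (2 * k) * B n ^ (2 * k * (m - 1) + 1)"
      by (simp only: power_add)
    hence "of_real \<alpha> ^ k / B n ^ (2 * k * (m - 1) + 1) = Y n / B n ^ (2 * k * m + 1)"
      using B_nz[of n] by (simp add: Y_def)
    hence "?f n = (-1) ^ n * (Y n / B n ^ (2 * k * m + 1)) * Z"
      unfolding f by (metis times_divide_eq_right)
    moreover have "of_real pi * ?g n = (-1) ^ n * (of_real pi * scaled_kernel_G \<alpha> c (B n) a k) / B n ^ (2 * k * m + 1)"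
      by simp
    moreover have "of_real pi * scaled_kernel_G \<alpha> c (B n) a k = zeta_E 1 a - Y n * Z"
      unfolding Z_def by (rule scaled_kernel_G_eq[OF prod c Arg])
    ultimately show ?thesis
      by (simp only:) (simp add: diff_divide_distrib right_diff_distrib mult_ac)
  qed
  ultimately have "(\<lambda>n. of_real pi * ?g n) sums (zeta_E 1 a * zeta_E (of_nat (2 * k * m + 1)) b - suminf ?f)"
    by simp
  hence "(\<lambda>n. of_real pi * ?g n / of_real pi) sums ((zeta_E 1 a * zeta_E (of_nat (2 * k * m + 1)) b - suminf ?f) / of_real pi)"
    by (rule sums_divide)
  thus ?thesis by (simp add: sums_iff)
qed

end

text \<open>The second identity carries the sign (-1)^(m+1), in contrast to (-1)^m in the English
  formula. At m = 1 the finite sum is empty and the two sides are the same double series with its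
  summations interchanged, so a nonzero value forces the sign +. The argument conditions on the
  first identity ensure absolute convergence of the kernel integrals, which would otherwise be 0 by
  the convention for nonintegrable functions.\<close>

theorem theorem1p26:
  fixes \<alpha> \<beta> c :: real and a b :: complex and k m :: nat
  assumes "\<alpha> > 0" and "\<beta> > 0" and "\<alpha> * \<beta> = pi ^ 2"
    and "k \<ge> 1" and "m \<ge> 1"
    and "1 < c" and "c < 2"
    and "a \<notin> \<int>\<^sub>\<le>\<^sub>0" and "b \<notin> \<int>\<^sub>\<le>\<^sub>0"
    and "\<And>n i :: nat. of_real \<alpha> ^ k * (of_nat i + b) ^ (2 * k)
                     + of_real \<beta> ^ k * (of_nat n + a) ^ (2 * k) \<noteq> 0"
  shows
    "(\<bar>Arg a\<bar> < pi / (2 * real k) \<and> \<bar>Arg b\<bar> < pi / (2 * real k) \<and>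
      \<bar>Arg a - Arg b\<bar> < pi / (2 * real k) \<longrightarrow>
        of_real \<beta> ^ (k * m) *
          (\<Sum>n. (-1) ^ n * scaled_kernel_G \<alpha> c (of_nat n + b) a k
                / (of_nat n + b) ^ (2 * k * m + 1))
      = (-1) ^ (m + 1) * of_real \<alpha> ^ (k * m) *
          (\<Sum>n. (-1) ^ n * scaled_kernel_G \<beta> c (of_nat n + a) b k
                / (of_nat n + a) ^ (2 * k * m + 1))
        + 1 / of_real pi *
          (\<Sum>p = 0..m. (-1) ^ p * zeta_E (of_nat (2 * k * p + 1)) a
                         * zeta_E (of_nat (2 * k * (m - p) + 1)) b
                         * of_real \<alpha> ^ (k * p) * of_real \<beta> ^ (k * (m - p))))
     \<and>
        (-1) ^ (m + 1) * of_real \<alpha> ^ (k * m) *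
          (\<Sum>n. (-1) ^ n * of_real \<beta> ^ k / (of_nat n + a) ^ (2 * k * (m - 1) + 1) *
             (\<Sum>i. (-1) ^ i / ((of_nat i + b) *
                 (of_real \<alpha> ^ k * (of_nat i + b) ^ (2 * k)
                  + of_real \<beta> ^ k * (of_nat n + a) ^ (2 * k)))))
      = of_real \<beta> ^ (k * m) *
          (\<Sum>n. (-1) ^ n * of_real \<alpha> ^ k / (of_nat n + b) ^ (2 * k * (m - 1) + 1) *
             (\<Sum>i. (-1) ^ i / ((of_nat i + a) *
                 (of_real \<beta> ^ k * (of_nat i + a) ^ (2 * k)
                  + of_real \<alpha> ^ k * (of_nat n + b) ^ (2 * k)))))
        + (\<Sum>p = 1..m - 1. (-1) ^ p * zeta_E (of_nat (2 * k * p + 1)) a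
                         * zeta_E (of_nat (2 * k * (m - p) + 1)) b
                         * of_real \<alpha> ^ (k * p) * of_real \<beta> ^ (k * (m - p)))"
proof -
  interpret zeta_pair \<alpha> \<beta> a b k
    using assms by unfold_locales auto
  interpret swap: zeta_pair \<beta> \<alpha> b a k
    by (rule zeta_pair_swap) unfold_locales
  note identity = double_series_identity[OF assms(5)]
  show ?thesis
  proof (intro conjI impI identity)
    assume Arg: "\<bar>Arg a\<bar> < pi / (2 * real k) \<and> \<bar>Arg b\<bar> < pi / (2 * real k) \<and>
      \<bar>Arg a - Arg b\<bar> < pi / (2 * real k)"
    define P where "P p = (-1) ^ p * zeta_E (of_nat (2 * k * p + 1)) a * zeta_E (of_nat (2 * k * (m - p) + 1)) b
      * of_real \<alpha> ^ (k * p) * of_real \<beta> ^ (k * (m - p))" for p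
    define G1 where "G1 = (\<Sum>n. (-1) ^ n * scaled_kernel_G \<alpha> c (of_nat n + b) a k
      / (of_nat n + b) ^ (2 * k * m + 1))"
    define G2 where "G2 = (\<Sum>n. (-1) ^ n * scaled_kernel_G \<beta> c (of_nat n + a) b k
      / (of_nat n + a) ^ (2 * k * m + 1))"
    define S1 where "S1 = (\<Sum>n. (-1) ^ n * of_real \<beta> ^ k / (of_nat n + a) ^ (2 * k * (m - 1) + 1) *
      (\<Sum>i. (-1) ^ i / ((of_nat i + b) *
        (of_real \<alpha> ^ k * (of_nat i + b) ^ (2 * k) + of_real \<beta> ^ k * (of_nat n + a) ^ (2 * k)))))"
    define S2 where "S2 = (\<Sum>n. (-1) ^ n * of_real \<alpha> ^ k / (of_nat n + b) ^ (2 * k * (m - 1) + 1) *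
      (\<Sum>i. (-1) ^ i / ((of_nat i + a) *
        (of_real \<beta> ^ k * (of_nat i + a) ^ (2 * k) + of_real \<alpha> ^ k * (of_nat n + b) ^ (2 * k)))))"
    have G1: "of_real pi * G1 = zeta_E 1 a * zeta_E (of_nat (2 * k * m + 1)) b - S2"
      unfolding G1_def S2_def using assms Arg by (intro kernel_series) auto
    have G2: "of_real pi * G2 = zeta_E 1 b * zeta_E (of_nat (2 * k * m + 1)) a - S1"
      unfolding G2_def S1_def using assms Arg by (intro swap.kernel_series) (auto simp: mult.commute abs_minus_commute)
    have S: "(-1) ^ (m + 1) * of_real \<alpha> ^ (k * m) * S1 = of_real \<beta> ^ (k * m) * S2 + (\<Sum>p = 1..m - 1. P p)"
      unfolding S1_def S2_def P_def by (rule identity)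
    obtain j where m: "m = Suc j" using assms(5) by (cases m) auto
    \<comment> \<open>The end terms p = 0 and p = m are exactly the products containing
      \<open>zeta_E 1 a\<close> and \<open>zeta_E 1 b\<close> in \<open>G1\<close> and
      \<open>G2\<close>; they are distinct because m is at least 1.\<close>
    have "{0..m} = insert 0 (insert m {1..m - 1})" by (auto simp: m)
    hence "(\<Sum>p = 0..m. P p) = P 0 + P m + (\<Sum>p = 1..m - 1. P p)"
      by (simp add: m)
    also have "P 0 = of_real \<beta> ^ (k * m) * (zeta_E 1 a * zeta_E (of_nat (2 * k * m + 1)) b)"
      by (simp add: P_def mult_ac)
    also have "P m = - ((-1) ^ (m + 1) * of_real \<alpha> ^ (k * m) * (zeta_E 1 b * zeta_E (of_nat (2 * k * m + 1)) a))"
      by (simp add: P_def mult_ac)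
    finally have "of_real pi * (of_real \<beta> ^ (k * m) * G1)
        = of_real pi * ((-1) ^ (m + 1) * of_real \<alpha> ^ (k * m) * G2) + (\<Sum>p = 0..m. P p)"
      using S unfolding mult.left_commute[of "of_real pi"] G1 G2 right_diff_distrib by simp
    hence "of_real \<beta> ^ (k * m) * G1 = (-1) ^ (m + 1) * of_real \<alpha> ^ (k * m) * G2 + 1 / of_real pi * (\<Sum>p = 0..m. P p)"
      by (simp add: field_simps)
    thus "of_real \<beta> ^ (k * m) *
          (\<Sum>n. (-1) ^ n * scaled_kernel_G \<alpha> c (of_nat n + b) a k / (of_nat n + b) ^ (2 * k * m + 1))
      = (-1) ^ (m + 1) * of_real \<alpha> ^ (k * m) *
          (\<Sum>n. (-1) ^ n * scaled_kernel_G \<beta> c (of_nat n + a) b k / (of_nat n + a) ^ (2 * k * m + 1))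
        + 1 / of_real pi *
          (\<Sum>p = 0..m. (-1) ^ p * zeta_E (of_nat (2 * k * p + 1)) a
                         * zeta_E (of_nat (2 * k * (m - p) + 1)) b
                         * of_real \<alpha> ^ (k * p) * of_real \<beta> ^ (k * (m - p)))"
      unfolding G1_def G2_def P_def .
  qed
qed

end
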